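(* Let $\mathbb F=\mathbb F_2$, let $M\in\mathbb F^{n\times n}$, and let $0<\varepsilon\le1/2$. Given an error-less oracle $\mathcal O:\mathbb F^n\to\mathbb F^n\cup\{\bot\}$ for $M$ with agreement at least $\varepsilon$ (and entry access to $M$), the warm-up algorithm described in the context outputs $Mx$ for any given $x\in\mathbb F^n$ with probability at least $2/3$ over the internal randomness. It makes $\widetilde O\left((2/\varepsilon)^{O(\log(1/\varepsilon))}\right)$ calls to $\mathcal O$ and $O(n\log(1/\varepsilon))$ entry queries to $M$. If one call to $\mathcal O$ costs time $T\ge n$, then the running time is $$\widetilde O\left((2/\varepsilon)^{O(\log(1/\varepsilon))}\,T\right).$$
   Context: **Oracle.** $\mathcal O:\mathbb F^n\to\mathbb F^n\cup\{\bot\}$ is *error-less* for $M$ with agreement at least $\varepsilon$ if (1) $\mathcal O(z)\in\{Mz,\bot\}$ for every $z\in\mathbb F^n$, and (2) $\Pr_{z\sim\mathbb F^n}[\mathcal O(z)=Mz]\ge\varepsilon$ for uniformly random $z$. An entry query to $M$ reveals one entry $M_{ij}$. Logarithms are base 2; $\widetilde O(\cdot)$ hides polylogarithmic factors in $n$, $1/\varepsilon$ and the relevant inverse error parameters. $\mathrm{supp}(v)$ is the set of nonzero coordinates of $v$ and $\mathrm{wt}(v)=|\mathrm{supp}(v)|$. **Parameters.** $t=O(\log(1/\varepsilon))$ is an integer with $t\ge\frac12\log(1/\varepsilon)+1$. Let $A=\{z:\mathcal O(z)=Mz\}$. The Bogolyubov–Ruzsa (BR) lemma gives a subspace $V\subseteq\mathbb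 F^n$ of codimension $O(\log(1/\varepsilon))$ such that for every $v\in V$, if $a_1,\dots,a_t,b_1,\dots,b_{t-1}$ are independent uniform vectors and $b_t=\sum_{i\le t} a_i-\sum_{i<t}b_i-v$, then all $a_i,b_i$ lie in $A$ with probability at least $\varepsilon^{2t+1}$. The algorithm does not know $V$. The number of rounds $L=O(\log(1/\varepsilon))$ is fixed and larger than the codimension of $V$; $Q=O(L\log n)$ is a fixed upper bound on the total number of calls to $\mathsf{Correct}$ below; and $R=\lceil C\varepsilon^{-(2t+1)}\log(Q+2)\rceil$ for a sufficiently large constant $C$. **Procedure $\mathsf{Correct}_{G,\Omega}(v)$.** $G=((g_1,h_1),\dots,(g_d,h_d))$ is a list of pairs with $h_i=Mg_i$. For $\alpha\in\mathbb F^d$ put $w_\alpha=\sum_i\alpha_ig_i$, $h_\alpha=\sum_i\alpha_ih_i$. A BR randomness table $\Omega$ for $G$ consists of independent uniform vectors $a_{\alpha,r,1},\dots,a_{\alpha,r,t},b_{\alpha,r,1},\dots,b_{\alpha,r,t-1}\in\mathbb F^n$ for all $\alpha\in\mathbb F^d$, $r\in\{1,\dots,R\}$. Given $v$, set $b_{\alpha,r,t}=\sum_{i\le t}a_{\alpha,r,i}-\sum_{i<t}b_{\alpha,r,i}-(v-w_\alpha)$ and form the candidate $y_{\alpha,r}=\sum_{i\le t}\mathcal O(a_{\alpha,r,i})-\sum_{i\le t}\mathcal O(b_{\alpha,r,i})+h_\alpha$, discarding it if any of its oracle answers is $\bot$. Return any remaining candidate, or $\bot$ if none remains. **Recursive procedure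 $\mathrm{Repair}(G,v)$** (intended for $v\notin W_G:=V+\mathrm{span}\{g:(g,h)\in G\}$). If $\mathrm{wt}(v)\le1$, compute $Mv$ directly from $M$, add $(v,Mv)$ to $G$, and return. Otherwise split $v=v_0+v_1$, each supported on roughly half of $\mathrm{supp}(v)$; sample fresh tables $\Omega_0,\Omega_1$ and compute $y_i=\mathsf{Correct}_{G,\Omega_i}(v_i)$ for $i=0,1$. If $y_0=\bot$, call $\mathrm{Repair}(G,v_0)$; otherwise, if $y_1=\bot$, call $\mathrm{Repair}(G,v_1)$; otherwise add $(v,y_0+y_1)$ to $G$. **Warm-up algorithm** (input $x$). Initialize $G=\emptyset$. Repeat for $L$ rounds: sample a fresh table $\Omega$ for the current $G$; compute $y=\mathsf{Correct}_{G,\Omega}(x)$; if $y\ne\bot$, output $y$ and stop; otherwise call $\mathrm{Repair}(G,x)$. *)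

theory Defs
  imports
    "HOL-Probability.Product_PMF"
    "HOL-Library.Z2"
    "HOL-Library.Monad_Syntax"
    "Jordan_Normal_Form.VS_Connect"
begin

unbundle no vec_syntax

text \<open>
  The space \<open>F^n\<close> is \<^term>\<open>carrier_vec n\<close> at type \<^typ>\<open>bit vec\<close>; an answer \<open>\<bottom>\<close> is
  \<^const>\<open>None\<close>.
\<close>

definition supp :: "bit vec \<Rightarrow> nat set" where
  "supp v = {i. i < dim_vec v \<and> v $ i \<noteq> 0}"

definition wt :: "bit vec \<Rightarrow> nat" where
  "wt v = card (supp v)"

definition vec_sum :: "nat \<Rightarrow> bit vec list \<Rightarrow> bit vec" where
  "vec_sum n us = foldr (+) us (0\<^sub>v n)"

definition uniform_vec :: "nat \<Rightarrow> bit vec pmf" where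
  "uniform_vec n = pmf_of_set (carrier_vec n)"

definition agreement_set :: "nat \<Rightarrow> bit mat \<Rightarrow> (bit vec \<Rightarrow> bit vec option) \<Rightarrow> bit vec set" where
  "agreement_set n M Orc = {z \<in> carrier_vec n. Orc z = Some (M *\<^sub>v z)}"

definition errorless_with_agreement ::
  "nat \<Rightarrow> bit mat \<Rightarrow> (bit vec \<Rightarrow> bit vec option) \<Rightarrow> real \<Rightarrow> bool" where
  "errorless_with_agreement n M Orc \<epsilon> \<longleftrightarrow>
     (\<forall>z\<in>carrier_vec n. Orc z \<in> {Some (M *\<^sub>v z), None}) \<and>
     measure_pmf.prob (uniform_vec n) {z. Orc z = Some (M *\<^sub>v z)} \<ge> \<epsilon>"

definition codim :: "nat \<Rightarrow> bit vec set \<Rightarrow> nat" where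
  "codim n V = n - vectorspace.dim class_ring ((module_vec TYPE(bit) n)\<lparr>carrier := V\<rparr>)"

text \<open>
  The property of the subspace supplied by the Bogolyubov--Ruzsa lemma. The families \<open>a\<close> and
  \<open>b\<close> are indexed by \<open>{1..t}\<close> and \<open>{1..<t}\<close>; the vector \<open>b\<^sub>t\<close> is determined by them and \<open>v\<close>.
\<close>

definition BR_last :: "nat \<Rightarrow> nat \<Rightarrow> (nat \<Rightarrow> bit vec) \<Rightarrow> (nat \<Rightarrow> bit vec) \<Rightarrow> bit vec \<Rightarrow> bit vec" where
  "BR_last n t a b v = vec_sum n (map a [1..<t+1]) - vec_sum n (map b [1..<t]) - v"

definition BR_subspace :: "nat \<Rightarrow> nat \<Rightarrow> real \<Rightarrow> bit vec set \<Rightarrow> bit vec set \<Rightarrow> bool" where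
  "BR_subspace n t \<epsilon> A V \<longleftrightarrow>
     VectorSpace.subspace class_ring V (module_vec TYPE(bit) n) \<and>
     (\<forall>v\<in>V. measure_pmf.prob
        (pair_pmf (Pi_pmf {1..t} (0\<^sub>v n) (\<lambda>_. uniform_vec n))
                  (Pi_pmf {1..<t} (0\<^sub>v n) (\<lambda>_. uniform_vec n)))
        {(a, b). (\<forall>i\<in>{1..t}. a i \<in> A) \<and> (\<forall>i\<in>{1..<t}. b i \<in> A) \<and> BR_last n t a b v \<in> A}
        \<ge> \<epsilon> ^ (2 * t + 1))"

text \<open>
  The component \<open>steps\<close> counts elementary operations other than oracle calls in a unit-cost
  model: a field operation, a random bit, an entry query, and reading, writing or comparing one
  coordinate each cost one step, so that a basic operation on vectors of length \<open>n\<close> costs \<open>n\<close>.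
  The component \<open>correct_calls\<close> counts the invocations of the procedure \<open>Correct\<close>.
\<close>

datatype cost =
  Cost (oracle_calls: nat) (entry_queries: nat) (correct_calls: nat) (steps: nat)

instantiation cost :: comm_monoid_add
begin

definition zero_cost :: cost where "0 = Cost 0 0 0 0"

definition plus_cost :: "cost \<Rightarrow> cost \<Rightarrow> cost" where
  "c + d = Cost (oracle_calls c + oracle_calls d) (entry_queries c + entry_queries d)
     (correct_calls c + correct_calls d) (steps c + steps d)"

instance
  by standard (simp_all add: zero_cost_def plus_cost_def)

end

text \<open>\<open>T\<close> is the time of one oracle call.\<close>

definition running_time :: "real \<Rightarrow> cost \<Rightarrow> real" where
  "running_time T c = T * real (oracle_calls c) + real (steps c)"

datatype 'a rand_comp = Rand_Comp (run: "('a \<times> cost) pmf")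

definition ret :: "'a \<Rightarrow> 'a rand_comp" where
  "ret x = Rand_Comp (return_pmf (x, 0))"

definition bind_comp :: "'a rand_comp \<Rightarrow> ('a \<Rightarrow> 'b rand_comp) \<Rightarrow> 'b rand_comp" where
  "bind_comp m f = Rand_Comp
     (bind_pmf (run m) (\<lambda>(x, c). map_pmf (\<lambda>(y, d). (y, c + d)) (run (f x))))"

adhoc_overloading Monad_Syntax.bind \<rightleftharpoons> bind_comp

definition charge :: "cost \<Rightarrow> unit rand_comp" where
  "charge c = Rand_Comp (return_pmf ((), c))"

abbreviation tick :: "nat \<Rightarrow> unit rand_comp" where
  "tick k \<equiv> charge (Cost 0 0 0 k)"

definition sample :: "'a pmf \<Rightarrow> 'a rand_comp" where
  "sample p = Rand_Comp (map_pmf (\<lambda>x. (x, 0)) p)"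

primrec map_comp :: "('a \<Rightarrow> 'b rand_comp) \<Rightarrow> 'a list \<Rightarrow> 'b list rand_comp" where
  "map_comp f [] = ret []"
| "map_comp f (x # xs) = do { y \<leftarrow> f x; ys \<leftarrow> map_comp f xs; ret (y # ys) }"

text \<open>
  A list of pairs \<open>(g, h)\<close> with \<open>h = M g\<close>. Coefficient vectors \<open>\<alpha> \<in> F^d\<close> are bit lists of
  length \<open>d\<close>. A randomness table consists of the families \<open>a\<close> and \<open>b\<close>, indexed by triples
  \<open>(\<alpha>, r, i)\<close>.
\<close>

type_synonym pairs = "(bit vec \<times> bit vec) list"
type_synonym table = "(bit list \<times> nat \<times> nat \<Rightarrow> bit vec) \<times> (bit list \<times> nat \<times> nat \<Rightarrow> bit vec)"

definition coeff_vectors :: "nat \<Rightarrow> bit list list" where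
  "coeff_vectors d = product_lists (replicate d [0, 1])"

text \<open>
  The algorithm leaves two choices open: how to split a vector into two vectors supported on
  halves of its support, and which remaining candidate to return. Both are parameters.
\<close>

definition halving :: "(bit vec \<Rightarrow> bit vec \<times> bit vec) \<Rightarrow> bool" where
  "halving split \<longleftrightarrow>
     (\<forall>v. 2 \<le> wt v \<longrightarrow>
        (case split v of (v0, v1) \<Rightarrow>
           dim_vec v0 = dim_vec v \<and> dim_vec v1 = dim_vec v \<and> v = v0 + v1 \<and>
           supp v0 \<subseteq> supp v \<and> supp v1 \<subseteq> supp v \<and>
           wt v0 \<le> (wt v + 1) div 2 \<and> wt v1 \<le> (wt v + 1) div 2))"

definition selecting :: "(bit vec list \<Rightarrow> bit vec) \<Rightarrow> bool" where
  "selecting pick \<longleftrightarrow> (\<forall>ys. ys \<noteq> [] \<longrightarrow> pick ys \<in> set ys)"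

locale warm_up =
  fixes n :: nat
    and M :: "bit mat"
    and Orc :: "bit vec \<Rightarrow> bit vec option"
    and t R :: nat
    and split :: "bit vec \<Rightarrow> bit vec \<times> bit vec"
    and pick :: "bit vec list \<Rightarrow> bit vec"
  assumes halving: "halving split"
    and selecting: "selecting pick"
begin

definition call :: "bit vec \<Rightarrow> bit vec option rand_comp" where
  "call z = do { charge (Cost 1 0 0 0); ret (Orc z) }"

definition entry :: "nat \<Rightarrow> nat \<Rightarrow> bit rand_comp" where
  "entry i j = do { charge (Cost 0 1 0 1); ret (M $$ (i, j)) }"

definition add :: "bit vec \<Rightarrow> bit vec \<Rightarrow> bit vec rand_comp" where
  "add u v = do { tick n; ret (u + v) }"

definition sub :: "bit vec \<Rightarrow> bit vec \<Rightarrow> bit vec rand_comp" where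
  "sub u v = do { tick n; ret (u - v) }"

definition sum_up :: "bit vec list \<Rightarrow> bit vec rand_comp" where
  "sum_up us = do { tick (n * (length us + 1)); ret (vec_sum n us) }"

definition combine :: "bit list \<Rightarrow> bit vec list \<Rightarrow> bit vec rand_comp" where
  "combine \<alpha> gs = do {
     tick (n * length gs);
     sum_up (map2 (\<lambda>c g. c \<cdot>\<^sub>v g) \<alpha> gs) }"

definition sample_table :: "nat \<Rightarrow> table rand_comp" where
  "sample_table d = (
     let I = {\<alpha>. length \<alpha> = d} \<times> {1..R} \<times> {1..t};
         J = {\<alpha>. length \<alpha> = d} \<times> {1..R} \<times> {1..<t}
     in do {
       tick (n * (card I + card J));
       sample (pair_pmf (Pi_pmf I (0\<^sub>v n) (\<lambda>_. uniform_vec n))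
                        (Pi_pmf J (0\<^sub>v n) (\<lambda>_. uniform_vec n))) })"

definition candidate ::
  "pairs \<Rightarrow> table \<Rightarrow> bit vec \<Rightarrow> bit list \<Rightarrow> nat \<Rightarrow> bit vec option rand_comp" where
  "candidate G \<Omega> v \<alpha> r = (
     let as = map (\<lambda>i. fst \<Omega> (\<alpha>, r, i)) [1..<t+1];
         bs = map (\<lambda>i. snd \<Omega> (\<alpha>, r, i)) [1..<t]
     in do {
       tick (length G + 1);
       w \<leftarrow> combine \<alpha> (map fst G);
       h \<leftarrow> combine \<alpha> (map snd G);
       sa \<leftarrow> sum_up as;
       sb \<leftarrow> sum_up bs;
       sab \<leftarrow> sub sa sb;
       u \<leftarrow> sub v w;
       bt \<leftarrow> sub sab u;
       ya \<leftarrow> map_comp call as;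
       yb \<leftarrow> map_comp call (bs @ [bt]);
       tick (2 * t);
       if None \<in> set (ya @ yb) then ret None
       else do {
         ta \<leftarrow> sum_up (map the ya);
         tb \<leftarrow> sum_up (map the yb);
         tab \<leftarrow> sub ta tb;
         y \<leftarrow> add tab h;
         ret (Some y) } })"

definition correct :: "pairs \<Rightarrow> table \<Rightarrow> bit vec \<Rightarrow> bit vec option rand_comp" where
  "correct G \<Omega> v = do {
     charge (Cost 0 0 1 0);
     ys \<leftarrow> map_comp (\<lambda>(\<alpha>, r). candidate G \<Omega> v \<alpha> r)
             (List.product (coeff_vectors (length G)) [1..<R+1]);
     tick (length ys + n);
     let zs = map the (filter (\<lambda>y. y \<noteq> None) ys);
     ret (if zs = [] then None else Some (pick zs)) }"

text \<open>
  For \<open>v = 0\<close> the product is zero and needs no query; for \<open>supp v = {j}\<close> it is column \<open>j\<close> of \<open>M\<close>.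
\<close>

definition direct :: "bit vec \<Rightarrow> bit vec rand_comp" where
  "direct v = do {
     tick n;
     if supp v = {} then ret (0\<^sub>v n)
     else do {
       cs \<leftarrow> map_comp (\<lambda>i. entry i (THE j. supp v = {j})) [0..<n];
       ret (vec_of_list cs) } }"

text \<open>
  Computing the weight costs \<open>n\<close> steps, splitting \<open>2 n\<close>, and storing a pair \<open>2 n\<close>.
\<close>

function repair :: "pairs \<Rightarrow> bit vec \<Rightarrow> pairs rand_comp" where
  "repair G v =
     (if wt v \<le> 1 then do {
        tick n;
        h \<leftarrow> direct v;
        tick (2 * n);
        ret (G @ [(v, h)]) }
      else do {
        tick (3 * n);
        \<Omega>0 \<leftarrow> sample_table (length G);
        \<Omega>1 \<leftarrow> sample_table (length G);
        y0 \<leftarrow> correct G \<Omega>0 (fst (split v));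
        y1 \<leftarrow> correct G \<Omega>1 (snd (split v));
        tick 2;
        if y0 = None then repair G (fst (split v))
        else if y1 = None then repair G (snd (split v))
        else do {
          y \<leftarrow> add (the y0) (the y1);
          tick (2 * n);
          ret (G @ [(v, y)]) } })"
  by pat_completeness auto
termination
proof (relation "Wellfounded.measure (\<lambda>(G, v). wt v)", simp)
  have *: "wt (fst (split v)) < wt v \<and> wt (snd (split v)) < wt v" if "\<not> wt v \<le> 1" for v
  proof -
    have "wt (fst (split v)) \<le> (wt v + 1) div 2 \<and> wt (snd (split v)) \<le> (wt v + 1) div 2"
      using halving[unfolded halving_def, rule_format, of v] that by (simp add: case_prod_beta)
    moreover have "(wt v + 1) div 2 < wt v"
      using that by simp
    ultimately show ?thesis by linarith
  qed
  fix G :: pairs and v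
  assume "\<not> wt v \<le> 1"
  then show "((G, fst (split v)), (G, v)) \<in> Wellfounded.measure (\<lambda>(G, v). wt v)"
    and "((G, snd (split v)), (G, v)) \<in> Wellfounded.measure (\<lambda>(G, v). wt v)"
    using * by auto
qed

declare repair.simps [simp del]

text \<open>The first argument is the number of remaining rounds; without output the result is \<^const>\<open>None\<close>.\<close>

primrec rounds :: "nat \<Rightarrow> pairs \<Rightarrow> bit vec \<Rightarrow> bit vec option rand_comp" where
  "rounds 0 G x = ret None"
| "rounds (Suc k) G x = do {
     \<Omega> \<leftarrow> sample_table (length G);
     y \<leftarrow> correct G \<Omega> x;
     tick 1;
     if y \<noteq> None then do { tick n; ret y }
     else do { G' \<leftarrow> repair G x; rounds k G' x } }"

definition warmup :: "nat \<Rightarrow> bit vec \<Rightarrow> bit vec option rand_comp" where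
  "warmup L x = rounds L [] x"

end

text \<open>
  \<open>Q\<close> bounds the number of calls to \<open>Correct\<close> in every execution, whatever the number \<open>R\<close> of
  repetitions is, since \<open>R\<close> is in turn chosen depending on \<open>Q\<close>.
\<close>

definition bounds_correct_calls ::
  "nat \<Rightarrow> bit mat \<Rightarrow> (bit vec \<Rightarrow> bit vec option) \<Rightarrow> nat \<Rightarrow> (bit vec \<Rightarrow> bit vec \<times> bit vec) \<Rightarrow>
   (bit vec list \<Rightarrow> bit vec) \<Rightarrow> nat \<Rightarrow> bit vec \<Rightarrow> nat \<Rightarrow> bool" where
  "bounds_correct_calls n M Orc t split pick L x Q \<longleftrightarrow>
     (\<forall>R. \<forall>(y, s) \<in> set_pmf (run (warm_up.warmup n M Orc t R split pick L x)).
        correct_calls s \<le> Q)"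

definition repetitions :: "real \<Rightarrow> real \<Rightarrow> nat \<Rightarrow> nat \<Rightarrow> nat" where
  "repetitions C \<epsilon> t Q = nat \<lceil>C * (1 / \<epsilon>) ^ (2 * t + 1) * log 2 (real Q + 2)\<rceil>"

text \<open>
  The shape \<open>(2/\<epsilon>)^{O(log(1/\<epsilon>))}\<close> up to factors polylogarithmic in \<open>n\<close> and \<open>1/\<epsilon>\<close>, with the implicit
  constants \<open>c\<close>, \<open>a\<close>, \<open>k\<close>. Using \<open>log (n + 1)\<close> for \<open>log n\<close> only matters for \<open>n = 1\<close>.
\<close>

definition soft_bound :: "real \<Rightarrow> real \<Rightarrow> nat \<Rightarrow> nat \<Rightarrow> real \<Rightarrow> real" where
  "soft_bound c a k n \<epsilon> =
     c * (2 / \<epsilon>) powr (a * log 2 (1 / \<epsilon>)) * (log 2 (real n + 1) * log 2 (1 / \<epsilon>)) ^ k"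

end

theory Submission imports Defs
begin

text \<open>
  Bogolyubov--Ruzsa: \<open>V\<close> is the common kernel of a maximal independent set of characters whose
  Fourier coefficient on \<open>A\<close> is at least a quarter of the trivial one; Chang's bound controls its
  codimension. Writing the probability as \<open>\<Sum>c. \<chi>\<^sub>c(v) S(c)\<^sup>2\<^sup>t\<close>, the large coefficients contribute
  nonnegatively for \<open>v \<in> V\<close>, and Parseval makes the others negligible.

  Algorithm: call an invocation of \<open>Correct\<close> on \<open>v \<in> W\<^sub>G\<close> that returns \<open>\<bottom>\<close> a failure. If none occurs,
  every call to \<open>Repair\<close> adds a vector outside \<open>W\<^sub>G\<close> and so doubles \<open>W\<^sub>G\<close>, which exhausts the space
  after \<open>codim V\<close> rounds. A failure means that \<open>R\<close> independent trials all miss an event of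
  probability at least \<open>\<epsilon> ^ (2 * t + 1)\<close>, and there are at most \<open>Q\<close> calls.
\<close>

section \<open>Binary vectors\<close>

text \<open>Since the oracle never errs, a candidate none of whose answers is \<bottom> is exact by
  linearity, so the only danger is a \<bottom> where an answer was due. Absent that, \<bottom>
  certifies that the vector lies outside \<open>W_G\<close>, and this steers the recursion of
  \<open>Repair\<close> although \<open>V\<close> is unknown.

  Two circularities have to be broken. \<open>R\<close> is chosen from \<open>Q\<close>, while
  \<open>Q\<close> counts the calls of an algorithm that contains \<open>R\<close>; but the number
  of calls is limited by the control flow alone, in every execution. And the vectors handed to
  \<open>Correct\<close> depend on earlier randomness; a table drawn just before each call makes the
  failure bound hold whatever the history is.

  On the Fourier side, independence of frequencies is stated as the vanishing of all sums of
  products of their characters. This is the form in which a Riesz product uses it, and it reduces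
  dimensions to cardinalities. Outside the spectrum, \<open>2 * t - 2\<close> spare factors 1/4 save
  \<open>\<epsilon>\<^sup>2\<close>, so the error is at most the fraction \<epsilon> of the main
  term.\<close>

lemma UNIV_bit: "(UNIV :: bit set) = {0, 1}"
  by (auto intro: bit.exhaust)

lemma bit_add_self [simp]: "(c :: bit) + c = 0"
  by (cases c) auto

lemma bit_vec_add_self [simp]: "v \<in> carrier_vec n \<Longrightarrow> v + v = (0\<^sub>v n :: bit vec)"
  by auto

lemma bit_vec_minus_eq_add: "dim_vec u = dim_vec v \<Longrightarrow> u - v = (u + v :: bit vec)"
  by (auto simp: vec_eq_iff)

lemma bit_vec_add_cancel [simp]:
  "x \<in> carrier_vec n \<Longrightarrow> y \<in> carrier_vec n \<Longrightarrow> x + y + y = (x :: bit vec)"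
  by (simp add: assoc_add_vec[of _ n])

lemma card_UNIV_bit: "card (UNIV :: bit set) = 2"
  by (simp add: UNIV_bit)

lemma finite_UNIV_bit [simp]: "finite (UNIV :: bit set)"
  by (simp add: UNIV_bit)

lemma finite_bit_lists [simp]: "finite {xs :: bit list. length xs = n}"
  using finite_lists_length_eq[of "UNIV :: bit set" n] by simp

lemma card_bit_lists: "card {xs :: bit list. length xs = n} = 2 ^ n"
  using card_lists_length_eq[of "UNIV :: bit set" n] by (simp add: card_UNIV_bit)

lemma bij_betw_vec_of_list: "bij_betw vec_of_list {xs. length xs = n} (carrier_vec n)"
proof (rule bij_betw_byWitness[where f' = list_of_vec])
  show "list_of_vec ` carrier_vec n \<subseteq> {xs. length xs = n}"
    using carrier_vecD by fastforce
  show "vec_of_list ` {xs. length xs = n} \<subseteq> carrier_vec n"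
    by (auto intro: carrier_vecI)
qed (simp_all add: list_vec vec_list)

lemma finite_bit_vecs [simp]: "finite (carrier_vec n :: bit vec set)"
  using bij_betw_finite[OF bij_betw_vec_of_list] finite_bit_lists by blast

lemma card_bit_vecs: "card (carrier_vec n :: bit vec set) = 2 ^ n"
  using bij_betw_same_card[OF bij_betw_vec_of_list] card_bit_lists by metis

lemma bij_betw_translation:
  "y \<in> carrier_vec n \<Longrightarrow> bij_betw (\<lambda>x. x + y) (carrier_vec n) (carrier_vec n :: bit vec set)"
  by (rule bij_betw_byWitness[where f' = "\<lambda>x. x + y"]) auto

text \<open>\<open>codim\<close> is defined through an abstract dimension, whereas the whole
  argument counts elements. Over the field with two elements a vector is a 0-1 choice on the basis,
  which links the two.\<close>

lemma card_subspace:
  assumes "VectorSpace.subspace class_ring V (module_vec TYPE(bit) n)"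
  shows "card V = 2 ^ vectorspace.dim class_ring ((module_vec TYPE(bit) n)\<lparr>carrier := V\<rparr>)"
proof -
  interpret vec_space "TYPE(bit)" n .
  interpret W: vectorspace class_ring "(module_vec TYPE(bit) n)\<lparr>carrier := V\<rparr>"
    using subspace_is_vs[OF assms] by simp
  have "V \<subseteq> carrier_vec n"
    using assms unfolding subspace_def submodule_def by simp
  then have "finite V"
    using finite_bit_vecs finite_subset by blast
  \<comment> \<open>Finite dimension comes for free: the finite set \<open>V\<close> generates
    itself.\<close>
  moreover have "W.gen_set V"
    using W.in_own_span[of V] W.span_is_subset2[of V] by auto
  ultimately have fd: "W.fin_dim"
    unfolding W.fin_dim_def by auto
  then obtain B where B: "finite B" "W.basis B"
    using W.finite_basis_exists by blast
  then have BV: "B \<subseteq> V" unfolding W.basis_def by simp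
  have *: "\<forall>v. v \<in> V \<longrightarrow> (\<exists>!a. a \<in> B \<rightarrow>\<^sub>E UNIV \<and> W.lincomb a B = v)"
    using W.basis_criterion[of B] B BV by (simp add: class_ring_simps)
  have "bij_betw (\<lambda>a. W.lincomb a B) (B \<rightarrow>\<^sub>E UNIV) V"
    unfolding bij_betw_def inj_on_def
  proof (intro conjI ballI impI)
    have cl: "W.lincomb a B \<in> V" if "a \<in> B \<rightarrow>\<^sub>E UNIV" for a
      using W.lincomb_closed[of B a] BV by (simp add: class_ring_simps)
    show "(\<lambda>a. W.lincomb a B) ` (B \<rightarrow>\<^sub>E UNIV) = V"
      using * cl by blast
    fix a b assume "a \<in> B \<rightarrow>\<^sub>E UNIV" "b \<in> B \<rightarrow>\<^sub>E UNIV" "W.lincomb a B = W.lincomb b B"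
    then show "a = b" using * cl by metis
  qed
  then have "card V = card (B \<rightarrow>\<^sub>E (UNIV :: bit set))"
    using bij_betw_same_card by metis
  also have "\<dots> = 2 ^ card B"
    using B(1) by (simp add: card_PiE card_UNIV_bit)
  also have "card B = W.dim"
    using W.dim_basis B by simp
  finally show ?thesis .
qed

section \<open>Sign characters and Chang's bound\<close>

definition chi :: "bit vec \<Rightarrow> bit vec \<Rightarrow> real" where
  "chi c x = (if scalar_prod c x = 0 then 1 else - 1)"

text \<open>Characters are captured by their functional equation instead of a frequency vector, so
  that products of several \<open>chi\<close> stay in the class without adding up
  frequencies.\<close>

definition sign_character :: "nat \<Rightarrow> (bit vec \<Rightarrow> real) \<Rightarrow> bool" where
  "sign_character n f \<longleftrightarrow> (\<forall>x\<in>carrier_vec n. f x = 1 \<or> f x = - 1) \<and>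
     (\<forall>x\<in>carrier_vec n. \<forall>y\<in>carrier_vec n. f (x + y) = f x * f y)"

lemma sign_characterD:
  assumes "sign_character n f" "x \<in> carrier_vec n"
  shows "f x = 1 \<or> f x = - 1" and "\<bar>f x\<bar> = 1"
  using assms unfolding sign_character_def by fastforce+

lemma sign_character_add:
  "sign_character n f \<Longrightarrow> x \<in> carrier_vec n \<Longrightarrow> y \<in> carrier_vec n \<Longrightarrow> f (x + y) = f x * f y"
  unfolding sign_character_def by blast

lemma sign_character_chi:
  assumes "c \<in> carrier_vec n" shows "sign_character n (chi c)"
  unfolding sign_character_def
proof (intro conjI ballI)
  fix x y :: "bit vec" assume "x \<in> carrier_vec n" "y \<in> carrier_vec n"
  then have "scalar_prod c (x + y) = scalar_prod c x + scalar_prod c y"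
    using assms by (simp add: scalar_prod_add_distrib)
  then show "chi c (x + y) = chi c x * chi c y"
    unfolding chi_def by (cases "scalar_prod c x"; cases "scalar_prod c y") auto
qed (auto simp: chi_def)

lemma chi_commute: "c \<in> carrier_vec n \<Longrightarrow> x \<in> carrier_vec n \<Longrightarrow> chi c x = chi x c"
  by (simp add: chi_def comm_scalar_prod[of c n x])

lemma sign_character_prod:
  "(\<And>b. b \<in> S \<Longrightarrow> sign_character n (f b)) \<Longrightarrow> sign_character n (\<lambda>x. \<Prod>b\<in>S. f b x)"
proof (induction S rule: infinite_finite_induct)
  case (insert b S)
  then have "sign_character n (f b)" "sign_character n (\<lambda>x. \<Prod>b\<in>S. f b x)" by auto
  moreover have "u * v = 1 \<or> u * v = - 1" if "u = 1 \<or> u = - 1" "v = 1 \<or> v = - 1" for u v :: real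
    using that by auto
  ultimately show ?case
    using insert(1,2) unfolding sign_character_def by (simp add: mult_ac)
qed (auto simp: sign_character_def)

text \<open>Translation by a point where \<open>f\<close> is -1 permutes the space and negates the
  sum.\<close>

lemma sum_sign_character:
  assumes f: "sign_character n f"
  shows "(\<Sum>x\<in>carrier_vec n. f x) = (if \<forall>x\<in>carrier_vec n. f x = 1 then 2 ^ n else 0)"
proof (cases "\<forall>x\<in>carrier_vec n. f x = 1")
  case True
  then show ?thesis by (simp add: card_bit_vecs)
next
  case False
  then obtain y where y: "y \<in> carrier_vec n" "f y = - 1"
    using sign_characterD(1)[OF f] by blast
  have "(\<Sum>x\<in>carrier_vec n. f x) = (\<Sum>x\<in>carrier_vec n. f (x + y))"
    by (rule sum.reindex_bij_betw[OF bij_betw_translation[OF y(1)], symmetric])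
  also have "\<dots> = (\<Sum>x\<in>carrier_vec n. - f x)"
    using y f by (intro sum.cong) (simp_all add: sign_character_add)
  finally have "(\<Sum>x\<in>carrier_vec n. f x) = 0"
    by (simp add: sum_negf)
  then show ?thesis using False by simp
qed

lemma sum_chi:
  assumes x: "x \<in> carrier_vec n"
  shows "(\<Sum>c\<in>carrier_vec n. chi c x) = (if x = 0\<^sub>v n then 2 ^ n else 0)"
proof -
  have "(\<Sum>c\<in>carrier_vec n. chi c x) = (\<Sum>c\<in>carrier_vec n. chi x c)"
    using x by (intro sum.cong) (auto intro: chi_commute)
  moreover have "(\<forall>c\<in>carrier_vec n. chi x c = 1) \<longleftrightarrow> x = 0\<^sub>v n"
  proof
    assume *: "\<forall>c\<in>carrier_vec n. chi x c = 1"
    have "x $ i = 0" if "i < n" for i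
    proof -
      have "chi x (unit_vec n i) = 1" using * by simp
      moreover have "scalar_prod x (unit_vec n i) = x $ i"
        using that by simp
      ultimately show ?thesis
        by (auto simp: chi_def split: if_splits)
    qed
    then show "x = 0\<^sub>v n" using x by auto
  qed (auto simp: chi_def)
  ultimately show ?thesis
    using sum_sign_character[OF sign_character_chi[OF x]] by presburger
qed

text \<open>Expanding the product over subsets of \<open>B\<close> leaves only the empty set. For
  characters the hypothesis is linear independence of the frequencies in disguise, since a character
  sums to zero exactly when it is nontrivial.\<close>

lemma sum_riesz_product:
  fixes f :: "'b \<Rightarrow> bit vec \<Rightarrow> real"
  assumes "finite B" "\<And>S. S \<subseteq> B \<Longrightarrow> S \<noteq> {} \<Longrightarrow> (\<Sum>x\<in>carrier_vec n. \<Prod>b\<in>S. f b x) = 0"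
  shows "(\<Sum>x\<in>carrier_vec n. \<Prod>b\<in>B. (w b * f b x + u)) = 2 ^ n * u ^ card B"
proof -
  have "(\<Sum>x\<in>carrier_vec n. \<Prod>b\<in>B. (w b * f b x + u))
      = (\<Sum>x\<in>carrier_vec n. \<Sum>S\<in>Pow B. (\<Prod>b\<in>S. w b * f b x) * (\<Prod>b\<in>B - S. u))"
    using assms(1) by (simp add: prod_add)
  also have "\<dots> = (\<Sum>S\<in>Pow B. \<Sum>x\<in>carrier_vec n. (\<Prod>b\<in>S. w b * f b x) * (\<Prod>b\<in>B - S. u))"
    by (rule sum.swap)
  also have "\<dots> = (\<Sum>S\<in>Pow B. (\<Prod>b\<in>S. w b) * u ^ card (B - S) * (\<Sum>x\<in>carrier_vec n. \<Prod>b\<in>S. f b x))"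
    by (simp add: prod.distrib sum_distrib_left mult_ac)
  also have "\<dots> = (\<Sum>S\<in>Pow B. if S = {} then 2 ^ n * u ^ card B else 0)"
    using assms(2) by (intro sum.cong) (auto simp: card_bit_vecs)
  also have "\<dots> = 2 ^ n * u ^ card B"
    using assms(1) by (simp add: sum.delta)
  finally show ?thesis .
qed

text \<open>On two points every function is affine, so the exponential becomes a factor of a Riesz
  product, with \<open>cosh l\<close> as \<open>u\<close> and \<open>sinh l\<close> as
  \<open>w\<close>. The bound \<open>exp (l\<^sup>2)\<close> is cruder than the usual
  \<open>exp (l\<^sup>2 / 2)\<close> and costs only a constant.\<close>

lemma exp_sign_le:
  assumes "0 \<le> l" "l \<le> 1"
  obtains u w :: real where "\<And>y. y = 1 \<or> y = - 1 \<Longrightarrow> exp (l * y) = w * y + u" "0 \<le> u" "u \<le> exp (l\<^sup>2)"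
proof
  let ?u = "(exp l + exp (- l)) / 2" and ?w = "(exp l - exp (- l)) / 2"
  show "exp (l * y) = ?w * y + ?u" if "y = 1 \<or> y = - 1" for y
    using that by (auto simp: field_simps)
  show "0 \<le> ?u" by (simp add: add_nonneg_nonneg)
  have "exp (- l) \<le> 1 / (1 + l)"
    using exp_ge_add_one_self[of l] assms by (simp add: exp_minus field_simps)
  also have "\<dots> \<le> 1 - l + l\<^sup>2"
    using assms by (simp add: field_simps power2_eq_square)
  finally have "?u \<le> 1 + l\<^sup>2"
    using exp_bound[OF assms] by simp
  also have "\<dots> \<le> exp (l\<^sup>2)" by (rule exp_ge_add_one_self)
  finally show "?u \<le> exp (l\<^sup>2)" .
qed

text \<open>
  Chang's bound. The exponential moment of \<open>\<Sum>b. s b * f b x\<close> is a Riesz product, so by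
  independence it factors over the whole space, while it is large on average over \<open>A\<close>.
\<close>

lemma card_independent_spectrum_le:
  fixes f :: "'b \<Rightarrow> bit vec \<Rightarrow> real" and \<theta> :: real
  assumes A: "A \<subseteq> carrier_vec n" "A \<noteq> {}" and B: "finite B"
    and f: "\<And>b. b \<in> B \<Longrightarrow> sign_character n (f b)"
    and indep: "\<And>S. S \<subseteq> B \<Longrightarrow> S \<noteq> {} \<Longrightarrow> (\<Sum>x\<in>carrier_vec n. \<Prod>b\<in>S. f b x) = 0"
    and large: "\<And>b. b \<in> B \<Longrightarrow> \<theta> * card A \<le> \<bar>\<Sum>x\<in>A. f b x\<bar>"
    and \<theta>: "0 \<le> \<theta>" "\<theta> \<le> 1"
  shows "\<theta>\<^sup>2 / 4 * card B \<le> ln (2 ^ n / card A)"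
proof -
  have finA: "finite A" using A(1) finite_bit_vecs finite_subset by blast
  then have cA: "card A > 0" using A(2) by (simp add: card_gt_0_iff)
  \<comment> \<open>This maximises \<open>l * \<theta> - l\<^sup>2\<close>, with value
    \<open>\<theta>\<^sup>2 / 4\<close>.\<close>
  define l where "l = \<theta> / 2"
  have l: "0 \<le> l" "l \<le> 1" using \<theta> by (auto simp: l_def)
  \<comment> \<open>The signs replace every coefficient by its absolute value, so that
    \<open>z\<close> has mean at least \<open>z0\<close> on \<open>A\<close>.\<close>
  define s :: "_ \<Rightarrow> real" where "s b = (if (\<Sum>x\<in>A. f b x) \<ge> 0 then 1 else - 1)" for b
  define z where "z x = (\<Sum>b\<in>B. l * (s b * f b x))" for x
  define z0 where "z0 = l * \<theta> * card B"
  obtain u w where uw: "\<And>y. y = 1 \<or> y = - 1 \<Longrightarrow> exp (l * y) = w * y + u" "0 \<le> u" "u \<le> exp (l\<^sup>2)"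
    using exp_sign_le[OF l] by blast
  have "(\<Sum>x\<in>A. z x) = (\<Sum>b\<in>B. l * (s b * (\<Sum>x\<in>A. f b x)))"
    unfolding z_def by (subst sum.swap) (simp add: sum_distrib_left)
  also have "\<dots> \<ge> (\<Sum>b\<in>B. l * (\<theta> * card A))"
  proof (intro sum_mono mult_left_mono)
    fix b assume "b \<in> B"
    then show "\<theta> * card A \<le> s b * (\<Sum>x\<in>A. f b x)"
      using large[of b] by (auto simp: s_def abs_if split: if_splits)
  qed (use l in auto)
  finally have zA: "z0 * card A \<le> (\<Sum>x\<in>A. z x)"
    by (simp add: z0_def mult_ac)
  \<comment> \<open>Jensen's inequality by hand: the exponential lies above its tangent at
    \<open>z0\<close>, and \<open>z0\<close> lies below the mean of \<open>z\<close> over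
    \<open>A\<close>.\<close>
  have "exp z0 * card A \<le> exp z0 * (card A + (\<Sum>x\<in>A. z x) - z0 * card A)"
    using zA by simp
  also have "\<dots> = (\<Sum>x\<in>A. exp z0 * (1 + (z x - z0)))"
    by (simp add: sum_distrib_left[symmetric] sum.distrib sum_subtractf mult.commute)
  also have "\<dots> \<le> (\<Sum>x\<in>A. exp z0 * exp (z x - z0))"
    by (intro sum_mono mult_left_mono exp_ge_add_one_self) auto
  also have "\<dots> = (\<Sum>x\<in>A. exp (z x))"
    by (simp add: exp_add[symmetric])
  also have "\<dots> \<le> (\<Sum>x\<in>carrier_vec n. exp (z x))"
    using A(1) by (intro sum_mono2) auto
  also have "\<dots> = (\<Sum>x\<in>carrier_vec n. \<Prod>b\<in>B. ((w * s b) * f b x + u))"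
  proof (intro sum.cong refl)
    fix x :: "bit vec" assume x: "x \<in> carrier_vec n"
    have "exp (l * (s b * f b x)) = (w * s b) * f b x + u" if "b \<in> B" for b
    proof -
      have "s b * f b x = 1 \<or> s b * f b x = - 1"
        using sign_characterD(1)[OF f[OF that] x] by (auto simp: s_def)
      from uw(1)[OF this] show ?thesis by (simp add: mult_ac)
    qed
    then show "exp (z x) = (\<Prod>b\<in>B. ((w * s b) * f b x + u))"
      unfolding z_def using B by (simp add: exp_sum)
  qed
  also have "\<dots> = 2 ^ n * u ^ card B"
    by (rule sum_riesz_product[OF B indep])
  also have "\<dots> \<le> 2 ^ n * exp (l\<^sup>2) ^ card B"
    using uw by (intro mult_left_mono power_mono) auto
  also have "exp (l\<^sup>2) ^ card B = exp (l\<^sup>2 * card B)"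
    by (simp add: exp_of_nat_mult[symmetric] mult.commute)
  finally have "exp (z0 - l\<^sup>2 * card B) \<le> 2 ^ n / card A"
    using cA by (simp add: exp_diff field_simps)
  then have "z0 - l\<^sup>2 * card B \<le> ln (2 ^ n / card A)"
    using cA by (subst ln_ge_iff) auto
  moreover have "z0 - l\<^sup>2 * card B = \<theta>\<^sup>2 / 4 * card B"
    by (simp add: z0_def l_def power2_eq_square field_simps)
  ultimately show ?thesis by simp
qed

section \<open>The Bogolyubov--Ruzsa lemma\<close>

lemma vec_sum_simps [simp]: "vec_sum n [] = 0\<^sub>v n" "vec_sum n (u # us) = u + vec_sum n us"
  by (simp_all add: vec_sum_def)

lemma vec_sum_closed [simp]: "set us \<subseteq> carrier_vec n \<Longrightarrow> vec_sum n us \<in> carrier_vec n"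
  by (induction us) auto

lemma sign_character_zero: "sign_character n f \<Longrightarrow> f (0\<^sub>v n) = 1"
  using sign_character_add[of n f "0\<^sub>v n" "0\<^sub>v n"] sign_characterD(1)[of n f "0\<^sub>v n"] by auto

lemma sign_character_vec_sum:
  assumes "sign_character n f" "set us \<subseteq> carrier_vec n"
  shows "f (vec_sum n us) = prod_list (map f us)"
  using assms(2)
  by (induction us) (simp_all add: sign_character_zero[OF assms(1)] sign_character_add[OF assms(1)])

section \<open>Fourier inversion and Parseval's identity\<close>

definition char_sum :: "bit vec set \<Rightarrow> bit vec \<Rightarrow> real" where
  "char_sum A c = (\<Sum>x\<in>A. chi c x)"

lemma char_sum_inversion:
  assumes A: "A \<subseteq> carrier_vec n" and y: "y \<in> carrier_vec n"
  shows "(\<Sum>c\<in>carrier_vec n. char_sum A c * chi c y) = 2 ^ n * of_bool (y \<in> A)"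
proof -
  have fin: "finite A" using A finite_bit_vecs finite_subset by blast
  have eq: "x + y = 0\<^sub>v n \<longleftrightarrow> x = y" if "x \<in> A" for x
  proof
    assume "x + y = 0\<^sub>v n"
    then have "x + y + y = y" using y by simp
    then show "x = y" using that A y by auto
  qed (use y in auto)
  have "(\<Sum>c\<in>carrier_vec n. char_sum A c * chi c y)
      = (\<Sum>x\<in>A. \<Sum>c\<in>carrier_vec n. chi c x * chi c y)"
    unfolding char_sum_def by (subst sum.swap) (simp add: sum_distrib_right)
  also have "\<dots> = (\<Sum>x\<in>A. \<Sum>c\<in>carrier_vec n. chi c (x + y))"
    using A y by (intro sum.cong) (auto simp: sign_character_add[OF sign_character_chi])
  also have "\<dots> = (\<Sum>x\<in>A. if x = y then 2 ^ n else 0)"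
    using A y eq by (intro sum.cong) (auto simp: sum_chi)
  finally show ?thesis using fin by simp
qed

lemma char_sum_parseval:
  assumes A: "A \<subseteq> carrier_vec n"
  shows "(\<Sum>c\<in>carrier_vec n. (char_sum A c)\<^sup>2) = 2 ^ n * card A"
proof -
  have "(\<Sum>c\<in>carrier_vec n. (char_sum A c)\<^sup>2)
      = (\<Sum>c\<in>carrier_vec n. \<Sum>y\<in>A. char_sum A c * chi c y)"
    by (simp add: power2_eq_square char_sum_def sum_distrib_left)
  also have "\<dots> = (\<Sum>y\<in>A. \<Sum>c\<in>carrier_vec n. char_sum A c * chi c y)"
    by (rule sum.swap)
  also have "\<dots> = (\<Sum>y\<in>A. 2 ^ n)"
    using A by (intro sum.cong refl) (subst char_sum_inversion, auto)
  finally show ?thesis by simp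
qed

text \<open>Product distributions live on total functions with a default value off the index set,
  while the distributive law concerns extensional functions; overwriting the values outside
  \<open>I\<close> matches the two.\<close>

lemma sum_prod_PiE_dflt:
  fixes g :: "'a \<Rightarrow> 'b \<Rightarrow> 'c :: comm_semiring_1"
  assumes "finite I" "\<And>i. i \<in> I \<Longrightarrow> finite (B i)"
  shows "(\<Sum>h\<in>PiE_dflt I d B. \<Prod>i\<in>I. g i (h i)) = (\<Prod>i\<in>I. \<Sum>x\<in>B i. g i x)"
proof -
  have "inj_on (\<lambda>h x. if x \<in> I then h x else d) (PiE I B)"
    by (rule inj_onI) (auto simp: fun_eq_iff PiE_def extensional_def split: if_splits, metis)
  then show ?thesis
    using assms
    by (simp add: prod_sum_PiE flip: dflt_image_PiE) (simp add: sum.reindex)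
qed

lemma pair_pmf_of_set:
  assumes "finite X" "X \<noteq> {}" "finite Y" "Y \<noteq> {}"
  shows "pair_pmf (pmf_of_set X) (pmf_of_set Y) = pmf_of_set (X \<times> Y)"
proof (rule pmf_eqI)
  fix z :: "'a \<times> 'b"
  show "pmf (pair_pmf (pmf_of_set X) (pmf_of_set Y)) z = pmf (pmf_of_set (X \<times> Y)) z"
    using assms by (cases z) (simp add: pmf_pair indicator_def)
qed

abbreviation BR_event :: "nat \<Rightarrow> nat \<Rightarrow> bit vec set \<Rightarrow> bit vec \<Rightarrow> ((nat \<Rightarrow> bit vec) \<times> (nat \<Rightarrow> bit vec)) set" where
  "BR_event n t A v \<equiv>
     {(a, b). (\<forall>i\<in>{1..t}. a i \<in> A) \<and> (\<forall>i\<in>{1..<t}. b i \<in> A) \<and> BR_last n t a b v \<in> A}"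

abbreviation families :: "nat \<Rightarrow> nat set \<Rightarrow> (nat \<Rightarrow> bit vec) set" where
  "families n I \<equiv> PiE_dflt I (0\<^sub>v n) (\<lambda>_. carrier_vec n)"

lemma BR_last_closed:
  assumes "a \<in> families n {1..t}" "b \<in> families n {1..<t}" "v \<in> carrier_vec n"
  shows "BR_last n t a b v \<in> carrier_vec n"
  using assms unfolding BR_last_def PiE_dflt_def by (intro minus_carrier_vec vec_sum_closed) auto

text \<open>Signs do not matter in characteristic two, so a character of the dependent vector
  factors over all the vectors that define it.\<close>

lemma sign_character_BR_last:
  assumes f: "sign_character n f"
    and ab: "a \<in> families n {1..t}" "b \<in> families n {1..<t}" and v: "v \<in> carrier_vec n"
  shows "f (BR_last n t a b v) = (\<Prod>i\<in>{1..t}. f (a i)) * (\<Prod>i\<in>{1..<t}. f (b i)) * f v"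
proof -
  let ?as = "map a [1..<t+1]" and ?bs = "map b [1..<t]"
  have as: "set ?as \<subseteq> carrier_vec n" and bs: "set ?bs \<subseteq> carrier_vec n"
    using ab unfolding PiE_dflt_def by auto
  have "BR_last n t a b v = vec_sum n ?as + vec_sum n ?bs + v"
    unfolding BR_last_def using vec_sum_closed[OF as] vec_sum_closed[OF bs] v
    by (subst bit_vec_minus_eq_add, simp add: carrier_vecD, subst bit_vec_minus_eq_add) (simp_all add: carrier_vecD)
  also have "f \<dots> = prod_list (map f ?as) * prod_list (map f ?bs) * f v"
    using vec_sum_closed[OF as] vec_sum_closed[OF bs] v as bs
    by (simp add: sign_character_add[OF f] sign_character_vec_sum[OF f])
  also have "prod_list (map f ?as) = (\<Prod>i\<in>{1..t}. f (a i))"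
    using prod.distinct_set_conv_list[of "[1..<t+1]" "\<lambda>i. f (a i)"]
    by (simp only: distinct_upt set_upt map_map o_def atLeastLessThanSuc_atLeastAtMost Suc_eq_plus1[symmetric])
  also have "prod_list (map f ?bs) = (\<Prod>i\<in>{1..<t}. f (b i))"
    using prod.distinct_set_conv_list[of "[1..<t]" "\<lambda>i. f (b i)"]
    by (simp only: distinct_upt set_upt map_map o_def)
  finally show ?thesis .
qed

lemma of_bool_Ball_eq_prod: "finite I \<Longrightarrow> of_bool (\<forall>i\<in>I. P i) = (\<Prod>i\<in>I. of_bool (P i) :: real)"
  by (induction I rule: finite_induct) auto

text \<open>Inversion is applied only to the membership of the dependent vector. The remaining
  memberships then decouple, and each free vector contributes one factor
  \<open>char_sum A c\<close>.\<close>

lemma BR_count: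
  assumes A: "A \<subseteq> carrier_vec n" and v: "v \<in> carrier_vec n" and t: "1 \<le> t"
  shows "2 ^ n * real (card (families n {1..t} \<times> families n {1..<t} \<inter> BR_event n t A v))
       = (\<Sum>c\<in>carrier_vec n. chi c v * char_sum A c ^ (2 * t))"
proof -
  let ?X = "families n {1..t}" and ?Y = "families n {1..<t}" and ?F = "carrier_vec n :: bit vec set"
  define p where "p c I h = (\<Prod>i\<in>I. of_bool (h i \<in> A) * chi c (h i))" for c and I :: "nat set" and h
  have fin: "finite ?X" "finite ?Y" by (auto intro!: finite_PiE_dflt)
  have p_sum: "(\<Sum>h\<in>families n I. p c I h) = char_sum A c ^ card I" if "finite I" for I c
  proof -
    have "(\<Sum>x\<in>?F. of_bool (x \<in> A) * chi c x) = char_sum A c"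
      unfolding char_sum_def using A by (intro sum.mono_neutral_cong_right) auto
    moreover have "(\<Sum>h\<in>families n I. p c I h) = (\<Prod>i\<in>I. \<Sum>x\<in>?F. of_bool (x \<in> A) * chi c x)"
      unfolding p_def using that by (intro sum_prod_PiE_dflt) auto
    ultimately show ?thesis by simp
  qed
  have event: "2 ^ n * of_bool ((a, b) \<in> BR_event n t A v)
      = (\<Sum>c\<in>?F. char_sum A c * chi c v * (p c {1..t} a * p c {1..<t} b))"
    if ab: "a \<in> ?X" "b \<in> ?Y" for a b
  proof -
    let ?P = "\<lambda>I h. \<Prod>i\<in>I. of_bool (h i \<in> A) :: real"
    have "2 ^ n * of_bool ((a, b) \<in> BR_event n t A v)
        = ?P {1..t} a * ?P {1..<t} b * (2 ^ n * of_bool (BR_last n t a b v \<in> A))"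
      by (simp add: of_bool_conj of_bool_Ball_eq_prod)
    also have "\<dots> = (\<Sum>c\<in>?F. ?P {1..t} a * ?P {1..<t} b * (char_sum A c * chi c (BR_last n t a b v)))"
      unfolding sum_distrib_left[symmetric] char_sum_inversion[OF A BR_last_closed[OF ab v]] ..
    also have "\<dots> = (\<Sum>c\<in>?F. char_sum A c * chi c v * (p c {1..t} a * p c {1..<t} b))"
      unfolding p_def
      by (intro sum.cong refl)
         (simp add: sign_character_BR_last[OF sign_character_chi ab v] prod.distrib mult_ac)
    finally show ?thesis .
  qed
  have "2 ^ n * real (card (?X \<times> ?Y \<inter> BR_event n t A v))
      = (\<Sum>(a, b)\<in>?X \<times> ?Y. 2 ^ n * of_bool ((a, b) \<in> BR_event n t A v))"
    using fin by (simp add: sum.If_cases of_bool_def case_prod_beta' flip: sum_distrib_left)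
  also have "\<dots> = (\<Sum>a\<in>?X. \<Sum>b\<in>?Y. \<Sum>c\<in>?F. char_sum A c * chi c v * (p c {1..t} a * p c {1..<t} b))"
    by (simp only: event sum.cartesian_product[symmetric] cong: sum.cong)
  also have "\<dots> = (\<Sum>a\<in>?X. \<Sum>c\<in>?F. \<Sum>b\<in>?Y. char_sum A c * chi c v * (p c {1..t} a * p c {1..<t} b))"
    by (intro sum.cong refl sum.swap)
  also have "\<dots> = (\<Sum>c\<in>?F. \<Sum>a\<in>?X. \<Sum>b\<in>?Y. char_sum A c * chi c v * (p c {1..t} a * p c {1..<t} b))"
    by (rule sum.swap)
  also have "\<dots> = (\<Sum>c\<in>?F. char_sum A c * chi c v * ((\<Sum>a\<in>?X. p c {1..t} a) * (\<Sum>b\<in>?Y. p c {1..<t} b)))"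
    by (simp add: sum_product flip: sum_distrib_left)
  also have "\<dots> = (\<Sum>c\<in>?F. chi c v * char_sum A c ^ (2 * t))"
  proof (intro sum.cong refl)
    fix c
    \<comment> \<open>One factor stems from inversion, \<open>t\<close> from the family
      \<open>a\<close> and \<open>t - 1\<close> from \<open>b\<close>.\<close>
    have "2 * t = 1 + (t + (t - 1))" using t by simp
    then have "char_sum A c ^ (2 * t) = char_sum A c * (char_sum A c ^ t * char_sum A c ^ (t - 1))"
      by (simp only: power_add power_one_right)
    then show "char_sum A c * chi c v * ((\<Sum>a\<in>?X. p c {1..t} a) * (\<Sum>b\<in>?Y. p c {1..<t} b))
        = chi c v * char_sum A c ^ (2 * t)"
      by (simp add: p_sum mult_ac)
  qed
  finally show ?thesis .
qed

lemma BR_prob: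
  assumes A: "A \<subseteq> carrier_vec n" and v: "v \<in> carrier_vec n" and t: "1 \<le> t"
  shows "measure_pmf.prob
        (pair_pmf (Pi_pmf {1..t} (0\<^sub>v n) (\<lambda>_. uniform_vec n))
                  (Pi_pmf {1..<t} (0\<^sub>v n) (\<lambda>_. uniform_vec n))) (BR_event n t A v)
       = (\<Sum>c\<in>carrier_vec n. chi c v * char_sum A c ^ (2 * t)) / (2 ^ n) ^ (2 * t)"
proof -
  let ?X = "families n {1..t}" and ?Y = "families n {1..<t}"
  have fin: "finite ?X" "finite ?Y" by (auto intro!: finite_PiE_dflt)
  have ne: "carrier_vec n \<noteq> ({} :: bit vec set)" by (metis empty_iff zero_carrier_vec)
  then have ne': "?X \<noteq> {}" "?Y \<noteq> {}" by simp_all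
  have XY: "?X \<times> ?Y \<noteq> {}" "finite (?X \<times> ?Y)"
    using fin ne' by (blast, simp)
  have "card ?X = (2 ^ n) ^ t" "card ?Y = (2 ^ n) ^ (t - 1)"
    by (simp_all add: card_PiE_dflt card_bit_vecs)
  then have "2 ^ n * real (card (?X \<times> ?Y)) = (2 ^ n) ^ (1 + (t + (t - 1)))"
    by (simp only: power_add power_one_right card_cartesian_product) simp
  also have "1 + (t + (t - 1)) = 2 * t" using t by simp
  finally have c: "2 ^ n * real (card (?X \<times> ?Y)) = (2 ^ n) ^ (2 * t)" .
  have "pair_pmf (Pi_pmf {1..t} (0\<^sub>v n) (\<lambda>_. uniform_vec n)) (Pi_pmf {1..<t} (0\<^sub>v n) (\<lambda>_. uniform_vec n))
      = pmf_of_set (?X \<times> ?Y)"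
    unfolding uniform_vec_def using ne ne' fin by (simp add: Pi_pmf_of_set pair_pmf_of_set)
  then have "measure_pmf.prob
        (pair_pmf (Pi_pmf {1..t} (0\<^sub>v n) (\<lambda>_. uniform_vec n))
                  (Pi_pmf {1..<t} (0\<^sub>v n) (\<lambda>_. uniform_vec n))) (BR_event n t A v)
      = real (card (?X \<times> ?Y \<inter> BR_event n t A v)) / real (card (?X \<times> ?Y))"
    using measure_pmf_of_set[OF XY] by simp
  \<comment> \<open>The extra \<open>2 ^ n\<close> completes the count of the
    \<open>2 * t - 1\<close> free vectors to the exponent \<open>2 * t\<close>.\<close>
  also have "\<dots> = 2 ^ n * real (card (?X \<times> ?Y \<inter> BR_event n t A v)) / (2 ^ n * real (card (?X \<times> ?Y)))"
    by simp
  finally show ?thesis unfolding c BR_count[OF assms] .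
qed

section \<open>The common kernel of the large characters\<close>

lemma subspaceI_bit:
  assumes "V \<subseteq> carrier_vec n" "0\<^sub>v n \<in> V" "\<And>u v. u \<in> V \<Longrightarrow> v \<in> V \<Longrightarrow> u + v \<in> V"
  shows "VectorSpace.subspace class_ring V (module_vec TYPE(bit) n)"
proof -
  interpret vec_space "TYPE(bit)" n .
  have "c \<cdot>\<^sub>v v \<in> V" if "v \<in> V" for c :: bit and v
  proof (cases c)
    case zero
    then have "c \<cdot>\<^sub>v v = 0\<^sub>v n" using that assms(1) by auto
    then show ?thesis using assms(2) by simp
  qed (use that in simp)
  then show ?thesis
    using assms vectorspace_axioms module_axioms unfolding subspace_def submodule_def
    by (simp add: module_vec_simps)
qed

text \<open>A further character at most halves the kernel: if it is -1 at some \<open>y\<close> of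
  the kernel, translation by \<open>y\<close> injects the part with value -1 into the part with
  value 1.\<close>

lemma card_common_kernel:
  assumes "finite B" "B \<subseteq> carrier_vec n"
  shows "2 ^ n \<le> card {v \<in> carrier_vec n. \<forall>b\<in>B. chi b v = 1} * 2 ^ card B"
  using assms
proof (induction B rule: finite_induct)
  case empty
  then show ?case by (simp add: card_bit_vecs)
next
  case (insert c B)
  let ?K = "{v \<in> carrier_vec n. \<forall>b\<in>B. chi b v = 1}"
  let ?K1 = "{v \<in> carrier_vec n. \<forall>b\<in>insert c B. chi b v = 1}"
  have char: "sign_character n (chi b)" if "b \<in> insert c B" for b
    using insert.prems that by (auto intro: sign_character_chi)
  have "card (?K - ?K1) \<le> card ?K1"
  proof (cases "?K - ?K1 = {}")
    case False
    then obtain y where y: "y \<in> carrier_vec n" "\<forall>b\<in>B. chi b y = 1" "chi c y = - 1"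
      using sign_characterD(1)[OF char[of c]] by blast
    show ?thesis
    proof (rule card_inj_on_le)
      show "inj_on (\<lambda>x. x + y) (?K - ?K1)"
        using bij_betw_translation[OF y(1)] by (auto intro: inj_on_subset simp: bij_betw_def)
      show "(\<lambda>x. x + y) ` (?K - ?K1) \<subseteq> ?K1"
      proof (rule image_subsetI)
        fix x assume x: "x \<in> ?K - ?K1"
        then have "chi c x = - 1" using sign_characterD(1)[OF char[of c]] by blast
        then show "x + y \<in> ?K1" using x y by (auto simp: sign_character_add[OF char])
      qed
    qed simp
  next
    case True
    then show ?thesis by (simp only: card.empty)
  qed
  moreover have "card ?K = card ?K1 + card (?K - ?K1)"
    by (subst card_Un_disjoint[symmetric]) (auto intro: arg_cong[where f = card])
  ultimately have "card ?K \<le> 2 * card ?K1" by linarith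
  then have "card ?K * 2 ^ card B \<le> card ?K1 * 2 ^ card (insert c B)"
    using insert.hyps by simp
  then show ?case
    using insert.IH insert.prems by simp
qed

text \<open>Here \<delta> is the density of \<open>A\<close>. The first term on the right comes from
  the trivial character, the second is the Parseval bound on the small coefficients. Their ratio
  \<open>1 / (4 ^ (2 * t - 2) * \<delta>)\<close> is at most \<epsilon> by the choice of
  \<open>t\<close>.\<close>

lemma spectral_bound:
  fixes \<epsilon> \<delta> :: real
  assumes \<epsilon>: "0 < \<epsilon>" "\<epsilon> \<le> 1 / 2" "\<epsilon> \<le> \<delta>" and t: "1 / 2 * log 2 (1 / \<epsilon>) + 1 \<le> real t"
  shows "\<epsilon> ^ (2 * t + 1) \<le> \<delta> ^ (2 * t) - (\<delta> / 4) ^ (2 * t - 2) * \<delta>"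
proof -
  have "0 \<le> log 2 (1 / \<epsilon>)" using \<epsilon> by (simp add: field_simps)
  then have t1: "1 \<le> t" using t by linarith
  define m where "m = 2 * t - 2"
  have m: "2 * t = m + 2" using t1 by (simp add: m_def)
  have "log 2 (1 / \<epsilon>) \<le> real m" using t m by linarith
  then have "1 / \<epsilon> \<le> 2 ^ m"
    using \<epsilon> by (subst (asm) log_le_iff) (auto simp: powr_realpow)
  then have "(1 / \<epsilon>)\<^sup>2 \<le> (2 ^ m)\<^sup>2"
    using \<epsilon> by (intro power_mono) auto
  also have "(2 ^ m)\<^sup>2 = (4 :: real) ^ m"
    by (simp add: power_mult[symmetric] mult.commute[of m]) (simp add: power_mult)
  finally have u: "1 / 4 ^ m \<le> \<epsilon>\<^sup>2"
    using \<epsilon> by (simp add: field_simps)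
  have "\<epsilon> ^ (2 * t + 1) = \<epsilon> ^ m * (\<epsilon> * (\<epsilon> * \<epsilon>))"
    by (simp add: m power_add power2_eq_square)
  \<comment> \<open>This amounts to \<open>\<epsilon> \<le> 1 - \<epsilon>\<close>, where
    \<open>\<epsilon> \<le> 1 / 2\<close> enters with full strength.\<close>
  also have "\<dots> \<le> \<epsilon> ^ m * (\<epsilon> * (\<epsilon> - \<epsilon>\<^sup>2))"
  proof (intro mult_left_mono)
    have "\<epsilon> * \<epsilon> \<le> \<epsilon> * (1 - \<epsilon>)"
      using \<epsilon> by (intro mult_left_mono) auto
    then show "\<epsilon> * \<epsilon> \<le> \<epsilon> - \<epsilon>\<^sup>2" by (simp add: power2_eq_square algebra_simps)
  qed (use \<epsilon> in auto)
  also have "\<dots> \<le> \<delta> ^ m * (\<delta> * (\<delta> - 1 / 4 ^ m))"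
  proof (intro mult_mono power_mono diff_mono)
    have "\<epsilon>\<^sup>2 \<le> \<epsilon>" using \<epsilon> by (simp add: power2_eq_square)
    then show "0 \<le> \<epsilon> - \<epsilon>\<^sup>2" by simp
    then show "0 \<le> \<epsilon> * (\<epsilon> - \<epsilon>\<^sup>2)" using \<epsilon> by simp
  qed (use \<epsilon> u in auto)
  also have "\<dots> = \<delta> ^ (2 * t) - (\<delta> / 4) ^ (2 * t - 2) * \<delta>"
    unfolding m_def[symmetric] m by (simp add: power_add power_divide power2_eq_square algebra_simps)
  finally show ?thesis .
qed

lemma bogolyubov_ruzsa:
  fixes A :: "bit vec set"
  assumes A: "A \<subseteq> carrier_vec n" and \<epsilon>: "0 < \<epsilon>" "\<epsilon> \<le> 1 / 2" "\<epsilon> \<le> card A / 2 ^ n"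
    and t: "1 / 2 * log 2 (1 / \<epsilon>) + 1 \<le> real t"
  obtains V where "BR_subspace n t \<epsilon> A V" "real (codim n V) \<le> 64 * log 2 (1 / \<epsilon>)"
proof -
  let ?F = "carrier_vec n :: bit vec set"
  \<comment> \<open>With a threshold of 1/2 the spare factors would save only \<epsilon>, which the
    main term need not exceed; 1/4 saves \<open>\<epsilon>\<^sup>2\<close>.\<close>
  define Spec where "Spec = {c \<in> ?F. 1 / 4 * real (card A) \<le> \<bar>char_sum A c\<bar>}"
  define indep where "indep B \<longleftrightarrow> B \<subseteq> Spec \<and> (\<forall>S\<subseteq>B. S \<noteq> {} \<longrightarrow> (\<Sum>x\<in>?F. \<Prod>b\<in>S. chi b x) = 0)" for B
  have "{B. indep B} \<subseteq> Pow ?F" by (auto simp: indep_def Spec_def)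
  then have "finite {B. indep B}" using finite_bit_vecs finite_subset by blast
  moreover have "{} \<in> {B. indep B}" by (simp add: indep_def)
  ultimately obtain B where B: "indep B" and max: "\<And>B'. indep B' \<Longrightarrow> B \<subseteq> B' \<Longrightarrow> B = B'"
    using finite_has_maximal[of "{B. indep B}"] by blast
  have BF: "B \<subseteq> ?F" using B by (auto simp: indep_def Spec_def)
  have finB: "finite B" using BF finite_bit_vecs finite_subset by blast
  have cA: "0 < real (card A)" using \<epsilon> by (cases "card A = 0") auto
  then have neA: "A \<noteq> {}" by auto
  define V where "V = {v \<in> ?F. \<forall>b\<in>B. chi b v = 1}"
  have VF: "V \<subseteq> ?F" by (auto simp: V_def)
  have sub: "VectorSpace.subspace class_ring V (module_vec TYPE(bit) n)"
  proof (rule subspaceI_bit[OF VF])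
    show "0\<^sub>v n \<in> V" using BF by (auto simp: V_def sign_character_zero[OF sign_character_chi])
    show "u + v \<in> V" if "u \<in> V" "v \<in> V" for u v
      using that BF by (auto simp: V_def sign_character_add[OF sign_character_chi])
  qed
  \<comment> \<open>By maximality a further large frequency depends on \<open>B\<close>: its
    character is a product of characters from \<open>B\<close>, hence trivial on
    \<open>V\<close>.\<close>
  have Spec_V: "chi c v = 1" if c: "c \<in> Spec" and v: "v \<in> V" for c v
  proof (cases "c \<in> B")
    case True
    then show ?thesis using v by (simp add: V_def)
  next
    case False
    then have "\<not> indep (insert c B)" using max by blast
    then obtain S where S: "S \<subseteq> insert c B" "S \<noteq> {}" "(\<Sum>x\<in>?F. \<Prod>b\<in>S. chi b x) \<noteq> 0"
      using c B unfolding indep_def by blast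
    have "c \<in> S" using S B unfolding indep_def by blast
    have SF: "S \<subseteq> ?F" using S(1) c BF by (auto simp: Spec_def)
    then have "sign_character n (\<lambda>x. \<Prod>b\<in>S. chi b x)"
      by (intro sign_character_prod sign_character_chi) auto
    from sum_sign_character[OF this] S(3) have "(\<Prod>b\<in>S. chi b v) = 1"
      using v VF by (auto split: if_splits)
    moreover have "(\<Prod>b\<in>S. chi b v) = chi c v * (\<Prod>b\<in>S - {c}. chi b v)"
      using \<open>c \<in> S\<close> SF finite_bit_vecs finite_subset by (blast intro: prod.remove)
    moreover have "(\<Prod>b\<in>S - {c}. chi b v) = 1"
      using S(1) v by (intro prod.neutral) (auto simp: V_def)
    ultimately show ?thesis by simp
  qed
  \<comment> \<open>The threshold 1/4 makes this factor 1/64, the source of the constant 64.\<close>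
  have "(1 / 4)\<^sup>2 / 4 * card B \<le> ln (2 ^ n / card A)"
    using B by (intro card_independent_spectrum_le[where f = chi] A neA finB sign_character_chi)
      (auto simp: indep_def Spec_def char_sum_def)
  also have "\<dots> \<le> ln (1 / \<epsilon>)"
    using \<epsilon> cA by (intro ln_mono) (auto simp: field_simps)
  also have "\<dots> \<le> log 2 (1 / \<epsilon>)"
  proof -
    have "ln (1 / \<epsilon>) * ln 2 \<le> ln (1 / \<epsilon>) * 1"
      using \<epsilon> ln_2_less_1 by (intro mult_left_mono) (auto simp: field_simps)
    then show ?thesis by (simp add: log_def field_simps)
  qed
  finally have cB: "real (card B) \<le> 64 * log 2 (1 / \<epsilon>)"
    by (simp add: power2_eq_square)
  have "(2 :: nat) ^ n \<le> 2 ^ (vectorspace.dim class_ring ((module_vec TYPE(bit) n)\<lparr>carrier := V\<rparr>) + card B)"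
    using card_common_kernel[OF finB BF] card_subspace[OF sub] by (simp add: V_def[symmetric] power_add)
  then have "codim n V \<le> card B"
    unfolding codim_def by (subst (asm) power_increasing_iff) auto
  with cB have codim: "real (codim n V) \<le> 64 * log 2 (1 / \<epsilon>)" by linarith
  have "0 \<le> log 2 (1 / \<epsilon>)" using \<epsilon> by (simp add: field_simps)
  then have t1: "1 \<le> t" using t by linarith
  have zero: "char_sum A (0\<^sub>v n) = card A"
    using A by (simp add: char_sum_def chi_def subset_iff)
  have prob: "\<epsilon> ^ (2 * t + 1) \<le> measure_pmf.prob
        (pair_pmf (Pi_pmf {1..t} (0\<^sub>v n) (\<lambda>_. uniform_vec n))
                  (Pi_pmf {1..<t} (0\<^sub>v n) (\<lambda>_. uniform_vec n))) (BR_event n t A v)"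
    if v: "v \<in> V" for v
  proof -
    define s where "s = real (card A)"
    define N :: real where "N = 2 ^ n"
    have N: "0 < N" by (simp add: N_def)
    \<comment> \<open>The error is charged to all frequencies, large ones included. This only
      weakens the bound, and it allows Parseval's identity together with a comparison term by term;
      large frequencies are harmless because the exponent is even.\<close>
    have "s ^ (2 * t) - (s / 4) ^ (2 * t - 2) * (N * s)
        = (\<Sum>c\<in>?F. (if c = 0\<^sub>v n then s ^ (2 * t) else 0) - (s / 4) ^ (2 * t - 2) * (char_sum A c)\<^sup>2)"
      by (simp add: sum_subtractf char_sum_parseval[OF A] N_def s_def flip: sum_distrib_left)
    also have "\<dots> \<le> (\<Sum>c\<in>?F. chi c v * char_sum A c ^ (2 * t))"
    proof (rule sum_mono)
      fix c assume c: "c \<in> ?F"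
      show "(if c = 0\<^sub>v n then s ^ (2 * t) else 0) - (s / 4) ^ (2 * t - 2) * (char_sum A c)\<^sup>2
          \<le> chi c v * char_sum A c ^ (2 * t)"
      proof (cases "c \<in> Spec")
        case True
        have "0 \<le> (s / 4) ^ (2 * t - 2) * (char_sum A c)\<^sup>2" by (simp add: s_def)
        moreover have "0 \<le> char_sum A c ^ (2 * t)" by (simp add: zero_le_even_power)
        ultimately show ?thesis
          using Spec_V[OF True v] zero by (cases "c = 0\<^sub>v n"; simp add: s_def[symmetric]; linarith)
      next
        case False
        then have ne: "c \<noteq> 0\<^sub>v n" using zero by (auto simp: Spec_def)
        have "2 * t = (2 * t - 2) + 2" using t1 by simp
        then have "\<bar>chi c v * char_sum A c ^ (2 * t)\<bar> = \<bar>char_sum A c\<bar> ^ (2 * t - 2) * (char_sum A c)\<^sup>2"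
          using v VF sign_characterD(2)[OF sign_character_chi[OF c]]
          by (metis (no_types, lifting) abs_mult mult_1 power_abs power_add power2_abs subsetD)
        also have "\<dots> \<le> (s / 4) ^ (2 * t - 2) * (char_sum A c)\<^sup>2"
          using False c by (intro mult_right_mono power_mono) (auto simp: Spec_def s_def)
        finally show ?thesis using ne by simp
      qed
    qed
    finally have "(s ^ (2 * t) - (s / 4) ^ (2 * t - 2) * (N * s)) / N ^ (2 * t)
        \<le> (\<Sum>c\<in>?F. chi c v * char_sum A c ^ (2 * t)) / N ^ (2 * t)"
      using N by (intro divide_right_mono) auto
    also have "(s ^ (2 * t) - (s / 4) ^ (2 * t - 2) * (N * s)) / N ^ (2 * t)
        = (s / N) ^ (2 * t) - (s / N / 4) ^ (2 * t - 2) * (s / N)"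
    proof -
      have "2 * t - 2 + 2 = 2 * t" using t1 by simp
      then have "N ^ (2 * t) = N ^ (2 * t - 2) * (N * N)"
        by (metis power_add power2_eq_square)
      then show ?thesis using N by (simp add: diff_divide_distrib power_divide)
    qed
    finally show ?thesis
      using spectral_bound[OF \<epsilon> t] BR_prob[OF A _ t1, of v] v VF by (auto simp: s_def N_def)
  qed
  have "BR_subspace n t \<epsilon> A V"
    unfolding BR_subspace_def using sub prob by auto
  then show ?thesis using that codim by blast
qed

section \<open>Randomised computations with costs\<close>

lemma run_simps [simp]:
  "run (ret x) = return_pmf (x, 0)"
  "run (charge c) = return_pmf ((), c)"
  "run (sample p) = map_pmf (\<lambda>x. (x, 0)) p"
  "run (bind_comp m f) = bind_pmf (run m) (\<lambda>(x, c). map_pmf (\<lambda>(y, d). (y, c + d)) (run (f x)))"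
  by (simp_all add: ret_def charge_def sample_def bind_comp_def)

lemma cost_simps [simp]:
  "oracle_calls (c + d) = oracle_calls c + oracle_calls d"
  "entry_queries (c + d) = entry_queries c + entry_queries d"
  "correct_calls (c + d) = correct_calls c + correct_calls d"
  "steps (c + d) = steps c + steps d"
  "oracle_calls 0 = 0" "entry_queries 0 = 0" "correct_calls 0 = 0" "steps 0 = 0"
  by (simp_all add: plus_cost_def zero_cost_def)

lemma bind_comp_assoc:
  "bind_comp (bind_comp m f) g = bind_comp m (\<lambda>x. bind_comp (f x) g)"
  by (rule rand_comp.expand)
     (simp add: map_pmf_def bind_assoc_pmf bind_return_pmf case_prod_beta' add.assoc)

text \<open>Costs add commutatively, so independent computations may be exchanged together with
  their charges. This allows a table to be drawn just before its use.\<close>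

lemma bind_comp_commute:
  "bind_comp m (\<lambda>x. bind_comp m' (f x)) = bind_comp m' (\<lambda>y. bind_comp m (\<lambda>x. f x y))"
proof (rule rand_comp.expand)
  show "run (bind_comp m (\<lambda>x. bind_comp m' (f x))) = run (bind_comp m' (\<lambda>y. bind_comp m (\<lambda>x. f x y)))"
    using bind_commute_pmf[of "run m" "run m'"
        "\<lambda>(x, c) (y, d). map_pmf (\<lambda>(z, e). (z, c + (d + e))) (run (f x y))"]
    by (simp add: map_pmf_def bind_assoc_pmf bind_return_pmf case_prod_beta' add.left_commute)
qed

definition always :: "'a rand_comp \<Rightarrow> ('a \<Rightarrow> cost \<Rightarrow> bool) \<Rightarrow> bool" where
  "always m P \<longleftrightarrow> (\<forall>(y, c)\<in>set_pmf (run m). P y c)"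

lemma alwaysD: "always m P \<Longrightarrow> (y, c) \<in> set_pmf (run m) \<Longrightarrow> P y c"
  by (auto simp: always_def)

lemma always_mono: "always m P \<Longrightarrow> (\<And>y c. P y c \<Longrightarrow> Q y c) \<Longrightarrow> always m Q"
  by (auto simp: always_def)

lemma always_bind:
  assumes "always m P" "\<And>y c. P y c \<Longrightarrow> always (f y) (\<lambda>z d. Q z (c + d))"
  shows "always (bind_comp m f) Q"
  using assms unfolding always_def by fastforce

lemma always_ret [simp]: "always (ret x) P \<longleftrightarrow> P x 0"
  by (simp add: always_def)

lemma always_charge [simp]: "always (charge c) P \<longleftrightarrow> P () c"
  by (simp add: always_def)

lemma always_charge_bind [simp]: "always (bind_comp (charge c) f) P \<longleftrightarrow> always (f ()) (\<lambda>y d. P y (c + d))"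
  by (simp add: always_def case_prod_beta')

lemma always_sample [simp]: "always (sample p) P \<longleftrightarrow> (\<forall>x\<in>set_pmf p. P x 0)"
  by (auto simp: always_def)

lemma always_map_comp:
  assumes "\<And>x. x \<in> set xs \<Longrightarrow> always (f x) (\<lambda>y c. P x y \<and> oracle_calls c \<le> a \<and>
    entry_queries c \<le> e \<and> correct_calls c = 0 \<and> steps c \<le> s)"
  shows "always (map_comp f xs) (\<lambda>ys c. list_all2 P xs ys \<and> oracle_calls c \<le> length xs * a \<and>
    entry_queries c \<le> length xs * e \<and> correct_calls c = 0 \<and> steps c \<le> length xs * s)"
  using assms
proof (induction xs)
  case (Cons x xs)
  show ?case
    unfolding map_comp.simps
    by (rule always_bind[OF Cons.prems[of x]], simp)
       (rule always_bind[OF Cons.IH[OF Cons.prems]]; simp)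
qed simp

text \<open>
  A union bound over adaptively chosen calls: a failure probability of \<open>p\<close> per call of \<open>Correct\<close>
  is charged to the expected number of calls, which makes the estimate compositional.
\<close>

definition hoare :: "ennreal \<Rightarrow> 'a rand_comp \<Rightarrow> ('a \<Rightarrow> bool) \<Rightarrow> bool" where
  "hoare p m \<Phi> \<longleftrightarrow> (\<integral>\<^sup>+(y, c). of_bool (\<not> \<Phi> y) \<partial>run m)
     \<le> p * (\<integral>\<^sup>+(y, c). of_nat (correct_calls c) \<partial>run m)"

lemma hoare_ret: "\<Phi> x \<Longrightarrow> hoare p (ret x) \<Phi>"
  by (simp add: hoare_def)

lemma hoare_always:
  assumes "always m (\<lambda>y c. \<Phi> y)"
  shows "hoare p m \<Phi>"
proof -
  have "(\<integral>\<^sup>+(y, c). of_bool (\<not> \<Phi> y) \<partial>run m) = (\<integral>\<^sup>+z. 0 \<partial>run m)"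
    using assms by (intro nn_integral_cong_AE) (auto simp: AE_measure_pmf_iff always_def)
  then show ?thesis by (simp add: hoare_def)
qed

text \<open>A run that violates \<Phi> has been paid for by \<open>m\<close>, so its continuation
  may fail for free; any other run is paid for by the calls in the continuation. The payments add up
  because expected numbers of calls do.\<close>

lemma hoare_bind:
  assumes m: "hoare p m \<Phi>" and f: "\<And>y. \<Phi> y \<Longrightarrow> hoare p (f y) \<Psi>"
  shows "hoare p (bind_comp m f) \<Psi>"
proof -
  let ?E = "\<lambda>y. \<integral>\<^sup>+(z, d). of_nat (correct_calls d) \<partial>run (f y)"
  have "(\<integral>\<^sup>+(z, c). of_bool (\<not> \<Psi> z) \<partial>run (bind_comp m f))
      = (\<integral>\<^sup>+(y, c). (\<integral>\<^sup>+(z, d). of_bool (\<not> \<Psi> z) \<partial>run (f y)) \<partial>run m)"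
    by (simp add: case_prod_beta')
  also have "\<dots> \<le> (\<integral>\<^sup>+(y, c). of_bool (\<not> \<Phi> y) + p * ?E y \<partial>run m)"
  proof (rule nn_integral_mono, clarify)
    fix y c
    show "(\<integral>\<^sup>+(z, d). of_bool (\<not> \<Psi> z) \<partial>run (f y)) \<le> of_bool (\<not> \<Phi> y) + p * ?E y"
    proof (cases "\<Phi> y")
      case True
      then show ?thesis using f[of y] by (simp add: hoare_def)
    next
      case False
      have "(\<integral>\<^sup>+(z, d). of_bool (\<not> \<Psi> z) \<partial>run (f y)) \<le> (\<integral>\<^sup>+z. 1 \<partial>run (f y))"
        by (intro nn_integral_mono) auto
      then show ?thesis using False by (simp add: add_increasing2)
    qed
  qed
  also have "\<dots> = (\<integral>\<^sup>+(y, c). of_bool (\<not> \<Phi> y) \<partial>run m) + p * (\<integral>\<^sup>+(y, c). ?E y \<partial>run m)"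
    by (simp add: case_prod_beta' nn_integral_add nn_integral_cmult)
  also have "\<dots> \<le> p * (\<integral>\<^sup>+(y, c). of_nat (correct_calls c) \<partial>run m) + p * (\<integral>\<^sup>+(y, c). ?E y \<partial>run m)"
    using m by (intro add_right_mono) (simp add: hoare_def)
  also have "\<dots> = p * (\<integral>\<^sup>+(y, c). of_nat (correct_calls c) + ?E y \<partial>run m)"
    by (simp add: case_prod_beta' nn_integral_add distrib_left)
  also have "(\<integral>\<^sup>+(y, c). of_nat (correct_calls c) + ?E y \<partial>run m)
      = (\<integral>\<^sup>+(z, c). of_nat (correct_calls c) \<partial>run (bind_comp m f))"
    by (simp add: case_prod_beta' nn_integral_add)
  finally show ?thesis by (simp add: hoare_def)
qed

lemma hoare_charge_bind: "hoare p (f ()) \<Psi> \<Longrightarrow> hoare p (bind_comp (charge c) f) \<Psi>"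
  by (rule hoare_bind[where \<Phi> = "\<lambda>_. True"]) (auto intro: hoare_always)

text \<open>A table keeps the families \<open>a\<close> and \<open>b\<close> apart; to split off one
  repetition, the four parts must be regrouped by repetition.\<close>

lemma pair_pmf_interchange:
  "pair_pmf (pair_pmf X1 X2) (pair_pmf Y1 Y2)
   = map_pmf (\<lambda>((x1, y1), (x2, y2)). ((x1, x2), (y1, y2))) (pair_pmf (pair_pmf X1 Y1) (pair_pmf X2 Y2))"
  unfolding pair_pmf_def
  by (simp add: map_bind_pmf bind_assoc_pmf bind_return_pmf)
     (subst bind_commute_pmf, rule refl)

lemma emeasure_pair_pmf_Times:
  "emeasure (measure_pmf (pair_pmf p q)) (A \<times> B) = emeasure (measure_pmf p) A * emeasure (measure_pmf q) B"
proof -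
  have "emeasure (measure_pmf (pair_pmf p q)) (A \<times> B) = (\<integral>\<^sup>+z. indicator (A \<times> B) z \<partial>pair_pmf p q)"
    by simp
  also have "\<dots> = (\<integral>\<^sup>+x. \<integral>\<^sup>+y. indicator A x * indicator B y \<partial>q \<partial>p)"
    by (simp add: nn_integral_pair_pmf' indicator_times del: nn_integral_indicator)
  finally show ?thesis by (simp add: nn_integral_cmult nn_integral_multc)
qed

section \<open>Randomness tables\<close>

text \<open>The default outside \<open>T\<close> gives a slice exactly the distribution that occurs
  in \<open>BR_subspace\<close>.\<close>

definition slice :: "bit vec \<Rightarrow> nat set \<Rightarrow> 'a \<Rightarrow> 'b \<Rightarrow> ('a \<times> 'b \<times> nat \<Rightarrow> bit vec) \<Rightarrow> nat \<Rightarrow> bit vec" where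
  "slice d T \<alpha> r a = (\<lambda>i. if i \<in> T then a (\<alpha>, r, i) else d)"

lemma map_slice_Pi_pmf:
  assumes "finite S" "finite T" "\<alpha> \<in> S"
  shows "map_pmf (slice d T \<alpha> r) (Pi_pmf (S \<times> {r} \<times> T) d (\<lambda>_. q)) = Pi_pmf T d (\<lambda>_. q)"
proof -
  have "Pi_pmf T d (\<lambda>_. q) = map_pmf (\<lambda>g. g \<circ> (\<lambda>i. (\<alpha>, r, i))) (Pi_pmf ({\<alpha>} \<times> {r} \<times> T) d (\<lambda>_. q))"
    using assms by (intro Pi_pmf_bij_betw) (auto simp: bij_betw_def inj_on_def)
  also have "Pi_pmf ({\<alpha>} \<times> {r} \<times> T) d (\<lambda>_. q)
      = map_pmf (\<lambda>f x. if x \<in> {\<alpha>} \<times> {r} \<times> T then f x else d) (Pi_pmf (S \<times> {r} \<times> T) d (\<lambda>_. q))"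
    using assms by (intro Pi_pmf_subset) auto
  finally show ?thesis
    by (simp add: pmf.map_comp o_def slice_def[abs_def])
qed

text \<open>For one coefficient vector, different repetitions read disjoint parts of the table,
  hence are independent and identically distributed. The induction splits off one repetition in both
  families at once.\<close>

lemma emeasure_all_slices:
  fixes Ev :: "((nat \<Rightarrow> bit vec) \<times> (nat \<Rightarrow> bit vec)) set" and Rs :: "'r set"
  assumes fin: "finite Rs" "finite S" "finite T" "finite T'" and \<alpha>: "\<alpha> \<in> S"
  shows "emeasure (measure_pmf (pair_pmf (Pi_pmf (S \<times> Rs \<times> T) d (\<lambda>_. q)) (Pi_pmf (S \<times> Rs \<times> T') d (\<lambda>_. q))))
      {(a, b). \<forall>r\<in>Rs. (slice d T \<alpha> r a, slice d T' \<alpha> r b) \<in> Ev}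
    = emeasure (measure_pmf (pair_pmf (Pi_pmf T d (\<lambda>_. q)) (Pi_pmf T' d (\<lambda>_. q)))) Ev ^ card Rs"
  using fin(1)
proof (induction Rs rule: finite_induct)
  case empty
  have "{(a, b). \<forall>r\<in>{}. (slice d T \<alpha> r a, slice d T' \<alpha> r b) \<in> Ev} = UNIV" by auto
  then show ?case by (simp add: measure_pmf.emeasure_space_1)
next
  case (insert r Rs)
  define P where "P T Rs = Pi_pmf (S \<times> Rs \<times> T) d (\<lambda>_. q)" for T :: "nat set" and Rs :: "'r set"
  define mrg where "mrg T = (\<lambda>(f, g) x. if x \<in> S \<times> {r} \<times> T then f x else g x :: bit vec)" for T :: "nat set"
  have split: "P T (insert r Rs) = map_pmf (mrg T) (pair_pmf (P T {r}) (P T Rs))" if "finite T" for T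
  proof -
    have "S \<times> insert r Rs \<times> T = (S \<times> {r} \<times> T) \<union> (S \<times> Rs \<times> T)" by auto
    moreover have "(S \<times> {r} \<times> T) \<inter> (S \<times> Rs \<times> T) = {}" using insert.hyps by auto
    ultimately show ?thesis
      unfolding P_def mrg_def using that fin insert.hyps by (subst \<open>_ = _ \<union> _\<close>, subst Pi_pmf_union) auto
  qed
  let ?all = "\<lambda>Rs. {(a, b). \<forall>r\<in>Rs. (slice d T \<alpha> r a, slice d T' \<alpha> r b) \<in> Ev}"
  let ?one = "{(a, b). (slice d T \<alpha> r a, slice d T' \<alpha> r b) \<in> Ev}"
  have slice_mrg: "slice d U \<alpha> r (mrg U (f, g)) = slice d U \<alpha> r f"
    "r' \<in> Rs \<Longrightarrow> slice d U \<alpha> r' (mrg U (f, g)) = slice d U \<alpha> r' g" for U f g r'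
    using \<alpha> insert.hyps by (auto simp: slice_def mrg_def)
  have "pair_pmf (P T (insert r Rs)) (P T' (insert r Rs))
      = map_pmf (\<lambda>(x, y). (mrg T x, mrg T' y))
          (pair_pmf (pair_pmf (P T {r}) (P T Rs)) (pair_pmf (P T' {r}) (P T' Rs)))"
    using fin by (simp add: split map_pair)
  also have "\<dots> = map_pmf (\<lambda>((x1, y1), (x2, y2)). (mrg T (x1, x2), mrg T' (y1, y2)))
          (pair_pmf (pair_pmf (P T {r}) (P T' {r})) (pair_pmf (P T Rs) (P T' Rs)))"
    by (subst pair_pmf_interchange) (simp add: pmf.map_comp o_def case_prod_beta')
  finally have "emeasure (measure_pmf (pair_pmf (P T (insert r Rs)) (P T' (insert r Rs)))) (?all (insert r Rs))
      = emeasure (measure_pmf (pair_pmf (pair_pmf (P T {r}) (P T' {r})) (pair_pmf (P T Rs) (P T' Rs)))) (?one \<times> ?all Rs)"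
    by (simp add: slice_mrg) (rule arg_cong[where f = "emeasure _"], auto simp: slice_mrg)
  also have "\<dots> = emeasure (measure_pmf (pair_pmf (P T {r}) (P T' {r}))) ?one
      * emeasure (measure_pmf (pair_pmf (P T Rs) (P T' Rs))) (?all Rs)"
    by (rule emeasure_pair_pmf_Times)
  also have "emeasure (measure_pmf (pair_pmf (P T {r}) (P T' {r}))) ?one
      = emeasure (measure_pmf (map_pmf (\<lambda>(a, b). (slice d T \<alpha> r a, slice d T' \<alpha> r b)) (pair_pmf (P T {r}) (P T' {r})))) Ev"
    by (simp add: vimage_def case_prod_beta')
  also have "map_pmf (\<lambda>(a, b). (slice d T \<alpha> r a, slice d T' \<alpha> r b)) (pair_pmf (P T {r}) (P T' {r}))
      = pair_pmf (Pi_pmf T d (\<lambda>_. q)) (Pi_pmf T' d (\<lambda>_. q))"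
    using fin \<alpha> by (simp add: map_pair P_def map_slice_Pi_pmf)
  finally show ?case
    using insert.IH insert.hyps by (simp add: P_def)
qed

section \<open>Cost of the algorithm\<close>

context warm_up
begin

definition lin_comb :: "bit list \<Rightarrow> bit vec list \<Rightarrow> bit vec" where
  "lin_comb \<alpha> gs = vec_sum n (map2 (\<lambda>c g. c \<cdot>\<^sub>v g) \<alpha> gs)"

lemma run_map_call: "run (map_comp call zs) = return_pmf (map Orc zs, Cost (length zs) 0 0 0)"
  by (induction zs) (simp_all add: call_def bind_return_pmf zero_cost_def plus_cost_def)

lemma always_basic_bind:
  "always (bind_comp (sum_up us) f) P \<longleftrightarrow>
     always (f (vec_sum n us)) (\<lambda>y d. P y (Cost 0 0 0 (n * (length us + 1)) + d))"
  "always (bind_comp (combine \<alpha> gs) f) P \<longleftrightarrow>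
     always (f (lin_comb \<alpha> gs)) (\<lambda>y d. P y (Cost 0 0 0 (n * length gs + n * (min (length \<alpha>) (length gs) + 1)) + d))"
  "always (bind_comp (sub u v) f') P' \<longleftrightarrow> always (f' (u - v)) (\<lambda>y d. P' y (Cost 0 0 0 n + d))"
  "always (bind_comp (add u v) f') P' \<longleftrightarrow> always (f' (u + v)) (\<lambda>y d. P' y (Cost 0 0 0 n + d))"
  "always (bind_comp (map_comp call zs) g) P'' \<longleftrightarrow>
     always (g (map Orc zs)) (\<lambda>y d. P'' y (Cost (length zs) 0 0 0 + d))"
  by (simp_all add: always_def sum_up_def combine_def sub_def add_def lin_comb_def run_map_call
      bind_return_pmf case_prod_beta' plus_cost_def zero_cost_def)

text \<open>Once the table is fixed, a candidate involves no randomness. Separating its value from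
  its cost keeps the correctness argument free of the monad.\<close>

definition candidate_value :: "pairs \<Rightarrow> table \<Rightarrow> bit vec \<Rightarrow> bit list \<Rightarrow> nat \<Rightarrow> bit vec option" where
  "candidate_value G \<Omega> v \<alpha> r = (
     let a = (\<lambda>i. fst \<Omega> (\<alpha>, r, i)); b = (\<lambda>i. snd \<Omega> (\<alpha>, r, i));
         bt = BR_last n t a b (v - lin_comb \<alpha> (map fst G));
         ya = map Orc (map a [1..<t+1]); yb = map Orc (map b [1..<t] @ [bt])
     in if None \<in> set (ya @ yb) then None
        else Some (vec_sum n (map the ya) - vec_sum n (map the yb) + lin_comb \<alpha> (map snd G)))"

lemma always_candidate:
  assumes "1 \<le> n" "1 \<le> t" "length \<alpha> = length G"
  shows "always (candidate G \<Omega> v \<alpha> r) (\<lambda>y c. candidate_value G \<Omega> v \<alpha> r = y \<and> oracle_calls c \<le> 2 * t \<and>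
    entry_queries c \<le> 0 \<and> correct_calls c = 0 \<and> steps c \<le> n * (5 * length G + 6 * t + 11))"
proof -
  define D where "D = length G"
  define as where "as = map (\<lambda>i. fst \<Omega> (\<alpha>, r, i)) [1..<t+1]"
  define bs where "bs = map (\<lambda>i. snd \<Omega> (\<alpha>, r, i)) [1..<t]"
  define w where "w = lin_comb \<alpha> (map fst G)"
  have len: "length as = t" "Suc (length bs) = t" "length \<alpha> = D" "length G = D"
    using assms by (simp_all add: as_def bs_def D_def)
  \<comment> \<open>Vector operations account for \<open>n * (4 * D + 4 * t + 10)\<close> steps;
    \<open>1 \<le> n\<close> absorbs the \<open>D + 2 * t + 1\<close> steps that carry no factor
    \<open>n\<close>.\<close>
  have "D + 2 * t + 1 \<le> n * (D + 2 * t + 1)"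
    using mult_le_mono1[OF assms(1), of "D + 2 * t + 1"] by simp
  then have le: "n * (4 * D + 4 * t + 10) + (D + 2 * t + 1) \<le> n * (5 * D + 6 * t + 11)"
    by (simp add: algebra_simps)
  have val: "candidate_value G \<Omega> v \<alpha> r = (let ya = map Orc as; yb = map Orc (bs @ [vec_sum n as - vec_sum n bs - (v - w)]) in
      if None \<in> set (ya @ yb) then None
      else Some (vec_sum n (map the ya) - vec_sum n (map the yb) + lin_comb \<alpha> (map snd G)))"
    unfolding candidate_value_def BR_last_def as_def bs_def w_def Let_def ..
  show ?thesis
    unfolding val candidate_def Let_def as_def[symmetric] bs_def[symmetric] always_basic_bind always_charge_bind
      w_def[symmetric] len
    using le by (cases "None \<in> set (map Orc as @ map Orc (bs @ [vec_sum n as - vec_sum n bs - (v - w)]))")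
      (simp_all only: if_True if_False always_basic_bind always_charge_bind always_ret,
       simp_all add: len algebra_simps)
qed

lemma length_coeff_vectors: "length (coeff_vectors d) = 2 ^ d"
  unfolding coeff_vectors_def by (induction d) (simp_all add: length_concat o_def)

lemma set_coeff_vectors: "set (coeff_vectors d) = {\<alpha>. length \<alpha> = d}"
  unfolding coeff_vectors_def
  by (auto simp: product_lists_set list_all2_conv_all_nth)

lemma always_correct:
  assumes "1 \<le> n" "1 \<le> t"
  shows "always (correct G \<Omega> v) (\<lambda>y c.
    (\<forall>z. y = Some z \<longrightarrow> (\<exists>\<alpha> r. length \<alpha> = length G \<and> candidate_value G \<Omega> v \<alpha> r = Some z)) \<and>
    (y = None \<longrightarrow> (\<forall>\<alpha> r. length \<alpha> = length G \<longrightarrow> r \<in> {1..R} \<longrightarrow> candidate_value G \<Omega> v \<alpha> r = None)) \<and>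
    oracle_calls c \<le> 2 ^ length G * R * (2 * t) \<and> entry_queries c = 0 \<and> correct_calls c = 1 \<and>
    steps c \<le> 2 ^ length G * R * (n * (5 * length G + 6 * t + 12)) + n)"
proof -
  let ?xs = "List.product (coeff_vectors (length G)) [1..<R+1]"
  let ?s = "n * (5 * length G + 6 * t + 11)"
  have "always (map_comp (\<lambda>(\<alpha>, r). candidate G \<Omega> v \<alpha> r) ?xs)
     (\<lambda>ys c. list_all2 (\<lambda>x y. (case x of (\<alpha>, r) \<Rightarrow> candidate_value G \<Omega> v \<alpha> r) = y) ?xs ys \<and>
       oracle_calls c \<le> length ?xs * (2 * t) \<and> entry_queries c \<le> length ?xs * 0 \<and>
       correct_calls c = 0 \<and> steps c \<le> length ?xs * ?s)"
    by (rule always_map_comp) (use always_candidate[OF assms, of _ G \<Omega> v] in \<open>auto simp: set_coeff_vectors\<close>)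
  then show ?thesis
    unfolding correct_def always_charge_bind
  proof (rule always_bind, elim conjE)
    fix ys c
    assume ys: "list_all2 (\<lambda>x y. (case x of (\<alpha>, r) \<Rightarrow> candidate_value G \<Omega> v \<alpha> r) = y) ?xs ys"
      and c: "oracle_calls c \<le> length ?xs * (2 * t)" "entry_queries c \<le> length ?xs * 0"
        "correct_calls c = 0" "steps c \<le> length ?xs * ?s"
    have ys_eq: "ys = map (\<lambda>(\<alpha>, r). candidate_value G \<Omega> v \<alpha> r) ?xs"
      using ys by (simp only: list_all2_map1[symmetric] list.rel_eq)
    have len: "length ?xs = 2 ^ length G * R" "length ys = 2 ^ length G * R"
      by (simp_all add: ys_eq length_coeff_vectors)
    let ?zs = "map the (filter (\<lambda>y. y \<noteq> None) ys)"
    have 1: "\<exists>\<alpha> r. length \<alpha> = length G \<and> candidate_value G \<Omega> v \<alpha> r = Some (pick ?zs)" if "?zs \<noteq> []"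
    proof -
      have "pick ?zs \<in> set ?zs" using selecting that unfolding selecting_def by blast
      then have "Some (pick ?zs) \<in> set ys" by auto
      then obtain x where x: "x \<in> set ?xs" "Some (pick ?zs) = (case x of (\<alpha>, r) \<Rightarrow> candidate_value G \<Omega> v \<alpha> r)"
        unfolding ys_eq set_map by (rule imageE)
      obtain \<alpha> r where \<alpha>: "x = (\<alpha>, r)" by (cases x)
      have "length \<alpha> = length G" using x(1) by (simp add: \<alpha> set_coeff_vectors del: upt_Suc)
      moreover have "candidate_value G \<Omega> v \<alpha> r = Some (pick ?zs)" using x(2) by (simp only: \<alpha> prod.case)
      ultimately show ?thesis by blast
    qed
    have 2: "candidate_value G \<Omega> v \<alpha> r = None"
      if "?zs = []" "length \<alpha> = length G" "r \<in> {1..R}" for \<alpha> r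
    proof -
      have "(\<alpha>, r) \<in> set ?xs" using that(2,3) by (auto simp: set_coeff_vectors simp del: upt_Suc)
      then have "(case (\<alpha>, r) of (\<alpha>, r) \<Rightarrow> candidate_value G \<Omega> v \<alpha> r) \<in> set ys"
        unfolding ys_eq set_map by (rule imageI)
      moreover have "\<forall>y\<in>set ys. y = None" using that(1) by (simp add: filter_empty_conv)
      ultimately show ?thesis by simp
    qed
    \<comment> \<open>Passing from 11 to 12 pays one step per candidate for the selection.\<close>
    have 3: "2 ^ length G * R * ?s + (2 ^ length G * R + n) \<le> 2 ^ length G * R * (n * (5 * length G + 6 * t + 12)) + n"
    proof -
      define X where "X = 2 ^ length G * R"
      have "X * ?s + X * 1 \<le> X * ?s + X * n" using assms(1) by (intro add_left_mono mult_le_mono) auto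
      also have "\<dots> = X * (n * (5 * length G + 6 * t + 12))" by (simp add: algebra_simps)
      finally show ?thesis by (simp add: X_def)
    qed
    show "always (bind_comp (tick (length ys + n))
        (\<lambda>_. let zs = ?zs in ret (if zs = [] then None else Some (pick zs))))
       (\<lambda>z d. (\<forall>za. z = Some za \<longrightarrow> (\<exists>\<alpha> r. length \<alpha> = length G \<and> candidate_value G \<Omega> v \<alpha> r = Some za)) \<and>
         (z = None \<longrightarrow> (\<forall>\<alpha> r. length \<alpha> = length G \<longrightarrow> r \<in> {1..R} \<longrightarrow> candidate_value G \<Omega> v \<alpha> r = None)) \<and>
         oracle_calls (Cost 0 0 1 0 + (c + d)) \<le> 2 ^ length G * R * (2 * t) \<and>
         entry_queries (Cost 0 0 1 0 + (c + d)) = 0 \<and> correct_calls (Cost 0 0 1 0 + (c + d)) = 1 \<and>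
         steps (Cost 0 0 1 0 + (c + d)) \<le> 2 ^ length G * R * (n * (5 * length G + 6 * t + 12)) + n)"
      proof (cases "?zs = []")
        case True
        show ?thesis
          unfolding Let_def if_P[OF True] always_charge_bind always_ret
          using c[unfolded len] 2[OF True] 3 by (simp add: len(2))
      next
        case False
        show ?thesis
          unfolding Let_def if_not_P[OF False] always_charge_bind always_ret
          using c[unfolded len] 1[OF False] 3 by (simp add: len(2))
      qed
  qed
qed

definition fresh_correct :: "pairs \<Rightarrow> bit vec \<Rightarrow> bit vec option rand_comp" where
  "fresh_correct G v = do { \<Omega> \<leftarrow> sample_table (length G); correct G \<Omega> v }"

definition oracle_bound :: "nat \<Rightarrow> nat" where
  "oracle_bound D = 2 ^ D * R * (2 * t)"

text \<open>\<open>8 * t\<close> consists of \<open>6 * t\<close> for evaluating a candidate and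
  \<open>2 * t\<close> for sampling its vectors. The factor \<open>R + 1\<close> keeps the bound
  positive when \<open>R = 0\<close>, as the estimates must hold for every \<open>R\<close>.\<close>

definition step_bound :: "nat \<Rightarrow> nat" where
  "step_bound D = n * (2 ^ D * (R + 1) * (5 * D + 8 * t + 20))"

text \<open>The slack \<open>5 * n\<close> pays for the bookkeeping around a call, so that later
  estimates can be expressed in numbers of calls.\<close>

lemma always_fresh_correct:
  assumes "1 \<le> n" "1 \<le> t" "length G \<le> D"
  shows "always (fresh_correct G v) (\<lambda>y c. oracle_calls c \<le> oracle_bound D \<and> entry_queries c = 0 \<and>
    correct_calls c = 1 \<and> steps c + 5 * n \<le> step_bound D)"
proof -
  define d where "d = length G"
  have d: "d \<le> D" "(2 :: nat) ^ d \<le> 2 ^ D" using assms(3) by (auto simp: d_def)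
  have "2 ^ d * R * (2 * t) \<le> oracle_bound D"
    unfolding oracle_bound_def using d(2) by (intro mult_le_mono) auto
  moreover have "n * (2 ^ d * (R * t) + 2 ^ d * (R * (t - 1))) +
      (2 ^ d * R * (n * (5 * d + 6 * t + 12)) + n) + 5 * n \<le> step_bound D"
  proof -
    have "n * (2 ^ d * (R * t) + 2 ^ d * (R * (t - 1))) +
      (2 ^ d * R * (n * (5 * d + 6 * t + 12)) + n) + 5 * n
      \<le> n * (2 ^ d * (R * t) + 2 ^ d * (R * t)) +
      (2 ^ d * R * (n * (5 * d + 6 * t + 12)) + n) + 5 * n"
      by (intro add_le_mono mult_le_mono) auto
    also have "\<dots> = n * (2 ^ d * R * (5 * d + 8 * t + 12) + 6)"
      by (simp add: algebra_simps)
    also have "\<dots> \<le> n * (2 ^ d * R * (5 * d + 8 * t + 20) + 2 ^ d * (5 * d + 8 * t + 20))"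
    proof (intro mult_le_mono add_le_mono le_refl)
      have "1 * 6 \<le> (2 :: nat) ^ d * (5 * d + 8 * t + 20)"
        by (intro mult_le_mono) auto
      then show "6 \<le> (2 :: nat) ^ d * (5 * d + 8 * t + 20)" by simp
    qed auto
    also have "\<dots> = n * (2 ^ d * (R + 1) * (5 * d + 8 * t + 20))"
      by (simp add: algebra_simps)
    also have "\<dots> \<le> step_bound D"
      unfolding step_bound_def using d by (intro mult_le_mono) auto
    finally show ?thesis .
  qed
  moreover have "card ({\<alpha> :: bit list. length \<alpha> = d} \<times> {1..R} \<times> {1..t}) = 2 ^ d * (R * t)"
    "card ({\<alpha> :: bit list. length \<alpha> = d} \<times> {1..R} \<times> {1..<t}) = 2 ^ d * (R * (t - 1))"
    by (simp_all add: card_cartesian_product card_bit_lists)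
  ultimately show ?thesis
    unfolding fresh_correct_def sample_table_def Let_def d_def[symmetric] bind_comp_assoc always_charge_bind
    by (intro always_bind[where P = "\<lambda>_ c. c = 0"])
       (auto intro!: always_mono[OF always_correct[OF assms(1,2), of G _ v]] simp: d_def)
qed

text \<open>
  The second table may be sampled after the first call of \<open>Correct\<close>, so that every call comes
  directly after the sampling of its own table.
\<close>

lemma repair_eq:
  "repair G v = (if wt v \<le> 1 then do {
        tick n;
        h \<leftarrow> direct v;
        tick (2 * n);
        ret (G @ [(v, h)]) }
      else do {
        tick (3 * n);
        y0 \<leftarrow> fresh_correct G (fst (split v));
        y1 \<leftarrow> fresh_correct G (snd (split v));
        tick 2;
        if y0 = None then repair G (fst (split v))
        else if y1 = None then repair G (snd (split v))
        else do {
          y \<leftarrow> add (the y0) (the y1);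
          tick (2 * n);
          ret (G @ [(v, y)]) } })"
  unfolding repair.simps[of G v] fresh_correct_def bind_comp_assoc
  by (subst bind_comp_commute[of "correct _ _ _"]) (rule refl)

lemma rounds_Suc:
  "rounds (Suc k) G x = do {
     y \<leftarrow> fresh_correct G x;
     tick 1;
     if y \<noteq> None then do { tick n; ret y }
     else do { G' \<leftarrow> repair G x; rounds k G' x } }"
  by (simp add: fresh_correct_def bind_comp_assoc)

end

lemma unit_vec_of_supp:
  assumes "v \<in> carrier_vec n" "supp v = {j}"
  shows "v = unit_vec n j" "j < n"
proof -
  have iff: "i < n \<and> v $ i \<noteq> 0 \<longleftrightarrow> i = j" for i
    using assms by (auto simp: supp_def)
  show j: "j < n" using iff by blast
  show "v = unit_vec n j"
  proof (rule eq_vecI)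
    fix i assume "i < dim_vec (unit_vec n j :: bit vec)"
    then show "v $ i = unit_vec n j $ i"
      using iff[of i] j by (cases "i = j") (auto simp: index_unit_vec)
  qed (use assms in auto)
qed

lemma zero_vec_of_supp:
  assumes "v \<in> carrier_vec n" "supp v = {}"
  shows "v = 0\<^sub>v n"
  using assms by (intro eq_vecI) (auto simp: supp_def)

lemma wt_le_1_cases:
  assumes "wt v \<le> 1"
  obtains "supp v = {}" | j where "supp v = {j}"
proof -
  have "finite (supp v)" by (simp add: supp_def)
  with assms show ?thesis
    using that unfolding wt_def by (metis card_0_eq card_1_singletonE le_Suc_eq le_zero_eq One_nat_def)
qed

lemma wt_le: "v \<in> carrier_vec n \<Longrightarrow> wt v \<le> n"
  unfolding wt_def supp_def using card_mono[of "{..<n}" "{i. i < dim_vec v \<and> v $ i \<noteq> 0}"]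
  by (auto simp: lessThan_def)

context warm_up
begin

lemma always_direct:
  "always (direct v) (\<lambda>h c. (M \<in> carrier_mat n n \<longrightarrow> v \<in> carrier_vec n \<longrightarrow> wt v \<le> 1 \<longrightarrow> h = M *\<^sub>v v) \<and>
     oracle_calls c = 0 \<and> entry_queries c \<le> n \<and> correct_calls c = 0 \<and> steps c \<le> 2 * n)"
proof (cases "supp v = {}")
  case True
  then show ?thesis
    using zero_vec_of_supp[of v n] by (auto simp: direct_def)
next
  case False
  define j where "j = (THE j. supp v = {j})"
  have entry: "always (entry i j) (\<lambda>y c. M $$ (i, j) = y \<and> oracle_calls c \<le> 0 \<and> entry_queries c \<le> 1 \<and>
     correct_calls c = 0 \<and> steps c \<le> 1)" for i
    by (simp add: entry_def)
  have val: "vec_of_list (map (\<lambda>i. M $$ (i, j)) [0..<n]) = M *\<^sub>v v"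
    if M: "M \<in> carrier_mat n n" and v: "v \<in> carrier_vec n" and wt: "wt v \<le> 1"
  proof -
    obtain k where k: "supp v = {k}" using wt_le_1_cases[OF wt] False by metis
    then have "k = j" by (simp add: j_def)
    with k have vj: "v = unit_vec n j" "j < n" using unit_vec_of_supp[OF v] by blast+
    show ?thesis
      using M vj(2) unfolding vj(1) by (intro eq_vecI) (auto simp: vec_of_list_index)
  qed
  have "always (map_comp (\<lambda>i. entry i j) [0..<n]) (\<lambda>ys c. list_all2 (\<lambda>i y. M $$ (i, j) = y) [0..<n] ys \<and>
     oracle_calls c \<le> length [0..<n] * 0 \<and> entry_queries c \<le> length [0..<n] * 1 \<and>
     correct_calls c = 0 \<and> steps c \<le> length [0..<n] * 1)"
    by (rule always_map_comp) (rule entry)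
  then show ?thesis
    unfolding direct_def if_not_P[OF False] j_def[symmetric] always_charge_bind
  proof (rule always_bind, elim conjE)
    fix cs c
    assume "list_all2 (\<lambda>i y. M $$ (i, j) = y) [0..<n] cs"
    then have "list_all2 (=) (map (\<lambda>i. M $$ (i, j)) [0..<n]) cs"
      by (simp only: list_all2_map1)
    then have "cs = map (\<lambda>i. M $$ (i, j)) [0..<n]"
      by (simp only: list.rel_eq)
    moreover assume "oracle_calls c \<le> length [0..<n] * 0" "entry_queries c \<le> length [0..<n] * 1"
      "correct_calls c = 0" "steps c \<le> length [0..<n] * 1"
    ultimately show "always (ret (vec_of_list cs))
      (\<lambda>h d. (M \<in> carrier_mat n n \<longrightarrow> v \<in> carrier_vec n \<longrightarrow> wt v \<le> 1 \<longrightarrow> h = M *\<^sub>v v) \<and>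
        oracle_calls (Cost 0 0 0 n + (c + d)) = 0 \<and> entry_queries (Cost 0 0 0 n + (c + d)) \<le> n \<and>
        correct_calls (Cost 0 0 0 n + (c + d)) = 0 \<and> steps (Cost 0 0 0 n + (c + d)) \<le> 2 * n)"
      using val by simp
  qed
qed

text \<open>The parameter \<open>k\<close> bounds the depth of halving. The one additional
  \<open>step_bound D\<close> pays for the end of the recursion, which can be reached without any
  call.\<close>

definition repair_cost :: "nat \<Rightarrow> nat \<Rightarrow> cost \<Rightarrow> bool" where
  "repair_cost D k c \<longleftrightarrow> oracle_calls c \<le> correct_calls c * oracle_bound D \<and> entry_queries c \<le> n \<and>
    correct_calls c \<le> 2 * k \<and> steps c \<le> (correct_calls c + 1) * step_bound D"

text \<open>Bounding the weight by a power of two absorbs the rounding, since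
  \<open>(2 ^ Suc k + 1) div 2 = 2 ^ k\<close>. Each level makes two calls but descends into at most
  one half, so the calls grow linearly in the depth.\<close>

lemma always_repair_cost:
  assumes n: "1 \<le> n" and t: "1 \<le> t" and G: "length G \<le> D" and k: "wt v \<le> 2 ^ k"
  shows "always (repair G v) (\<lambda>G' c. length G' = Suc (length G) \<and> repair_cost D k c)"
  using k
proof (induction k arbitrary: v)
  have S: "5 * n \<le> step_bound D"
  proof -
    have "n * (1 * 1 * 5) \<le> step_bound D"
      unfolding step_bound_def by (intro mult_le_mono) auto
    then show ?thesis by simp
  qed
  note correct = always_bind[OF always_fresh_correct[OF n t G]]
  have leaf: "always (repair G v) (\<lambda>G' c. length G' = Suc (length G) \<and> repair_cost D k c)"
    if "wt v \<le> 1" for v k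
    unfolding repair_eq[of G v] if_P[OF that] always_charge_bind
    using S by (intro always_bind[OF always_direct]) (auto simp: repair_cost_def)
  {
    case 0
    then show ?case by (intro leaf) simp
  next
    case (Suc k)
    show ?case
    proof (cases "wt v \<le> 1")
      case True
      then show ?thesis by (rule leaf)
    next
      case False
      have half: "wt (fst (split v)) \<le> 2 ^ k" "wt (snd (split v)) \<le> 2 ^ k"
        using halving[unfolded halving_def, rule_format, of v] False Suc.prems
        by (auto simp: case_prod_beta)
      show ?thesis
        unfolding repair_eq[of G v] if_not_P[OF False] always_charge_bind
      proof (rule correct, rule correct, unfold always_charge_bind)
        fix y0 y1 c0 c1
        assume c0: "oracle_calls c0 \<le> oracle_bound D \<and> entry_queries c0 = 0 \<and> correct_calls c0 = 1 \<and>
            steps c0 + 5 * n \<le> step_bound D"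
          and c1: "oracle_calls c1 \<le> oracle_bound D \<and> entry_queries c1 = 0 \<and> correct_calls c1 = 1 \<and>
            steps c1 + 5 * n \<le> step_bound D"
        let ?c = "\<lambda>c. Cost 0 0 0 (3 * n) + (c0 + (c1 + (Cost 0 0 0 2 + c)))"
        have step: "repair_cost D (Suc k) (?c c)" if "repair_cost D k c" for c
          using that c0 c1 n by (simp add: repair_cost_def)
        have branch: "always (repair G u) (\<lambda>G' c. length G' = Suc (length G) \<and> repair_cost D (Suc k) (?c c))"
          if "wt u \<le> 2 ^ k" for u
          by (rule always_mono[OF Suc.IH[OF that]]) (auto intro: step)
        have last: "always (do { y \<leftarrow> add (the y0) (the y1); tick (2 * n); ret (G @ [(v, y)]) })
            (\<lambda>G' c. length G' = Suc (length G) \<and> repair_cost D (Suc k) (?c c))"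
          unfolding always_basic_bind always_charge_bind always_ret
          using S by (auto intro!: step simp: repair_cost_def[of D k])
        show "always (if y0 = None then repair G (fst (split v))
            else if y1 = None then repair G (snd (split v))
            else do { y \<leftarrow> add (the y0) (the y1); tick (2 * n); ret (G @ [(v, y)]) })
          (\<lambda>G' c. length G' = Suc (length G) \<and> repair_cost D (Suc k) (?c c))"
          using branch[OF half(1)] branch[OF half(2)] last by (simp only: split: if_split) blast
      qed
    qed
  }
qed

text \<open>A round that goes on appends exactly one pair, so \<open>length G + k\<close> stays
  constant and \<open>D\<close> bounds the list in all calls. The factor 2 in the step count lets
  the first call of a round cover the surplus of \<open>repair_cost\<close>.\<close>

lemma always_rounds_cost:
  assumes n: "1 \<le> n" and t: "1 \<le> t" and wt: "wt x \<le> 2 ^ \<kappa>" and G: "length G + k \<le> D"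
  shows "always (rounds k G x) (\<lambda>y c. oracle_calls c \<le> correct_calls c * oracle_bound D \<and>
    entry_queries c \<le> k * n \<and> correct_calls c \<le> k * (1 + 2 * \<kappa>) \<and> steps c \<le> correct_calls c * (2 * step_bound D))"
  using G
proof (induction k arbitrary: G)
  case (Suc k)
  then have G: "length G \<le> D" by simp
  show ?case
    unfolding rounds_Suc
  proof (rule always_bind[OF always_fresh_correct[OF n t G]], unfold always_charge_bind)
    fix y c0
    assume c0: "oracle_calls c0 \<le> oracle_bound D \<and> entry_queries c0 = 0 \<and> correct_calls c0 = 1 \<and>
        steps c0 + 5 * n \<le> step_bound D"
    let ?P = "\<lambda>c. oracle_calls c \<le> correct_calls c * oracle_bound D \<and>
       entry_queries c \<le> Suc k * n \<and> correct_calls c \<le> Suc k * (1 + 2 * \<kappa>) \<and>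
       steps c \<le> correct_calls c * (2 * step_bound D)"
    show "always (if y \<noteq> None then do { tick n; ret y } else do { G' \<leftarrow> repair G x; rounds k G' x })
       (\<lambda>z c. ?P (c0 + (Cost 0 0 0 1 + c)))"
    proof (cases "y = None")
      case False
      then show ?thesis using c0 n by simp
    next
      case True
      have "always (do { G' \<leftarrow> repair G x; rounds k G' x }) (\<lambda>z c. ?P (c0 + (Cost 0 0 0 1 + c)))"
      proof (rule always_bind[OF always_repair_cost[OF n t G wt]])
        fix G' :: pairs and c1
        assume c1: "length G' = Suc (length G) \<and> repair_cost D \<kappa> c1"
        then have "length G' + k \<le> D" using Suc.prems by simp
        from Suc.IH[OF this] show "always (rounds k G' x) (\<lambda>z d. ?P (c0 + (Cost 0 0 0 1 + (c1 + d))))"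
          by (rule always_mono) (use c0 c1 n in \<open>auto simp: repair_cost_def algebra_simps\<close>)
      qed
      with True show ?thesis by simp
    qed
  qed
qed simp

end

section \<open>Success probability\<close>

lemma bit_vec_add_diff_cancel:
  assumes "x \<in> carrier_vec n" "y \<in> carrier_vec n" "z \<in> carrier_vec n"
  shows "x + z - (y + z) = (x - y :: bit vec)"
proof -
  have "a + c - (b + c) = a - b" for a b c :: bit
    by (cases a; cases b; cases c) simp_all
  then show ?thesis
    using assms by (intro eq_vecI) (simp_all add: carrier_vecD del: minus_bit_def)
qed

text \<open>The reason for the choice of the dependent vector: with \<open>x\<close> and
  \<open>y\<close> the sums of the two random families, all randomness cancels and \<open>v\<close>
  remains.\<close>

lemma bit_vec_telescope:
  assumes "x \<in> carrier_vec n" "y \<in> carrier_vec n" "v \<in> carrier_vec n" "w \<in> carrier_vec n"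
  shows "x - (y + (x - y - (v - w))) + w = (v :: bit vec)"
proof -
  have "a - (b + (a - b - (c - d))) + d = c" for a b c d :: bit
    by (cases a; cases b; cases c; cases d) simp_all
  then show ?thesis
    using assms by (intro eq_vecI) (simp_all add: carrier_vecD del: minus_bit_def)
qed

lemma vec_sum_append:
  "set us \<subseteq> carrier_vec n \<Longrightarrow> set vs \<subseteq> carrier_vec n \<Longrightarrow> vec_sum n (us @ vs) = vec_sum n us + vec_sum n vs"
  by (induction us) (simp_all add: assoc_add_vec[of _ n])

lemma mult_mat_zero_vec: "M \<in> carrier_mat n n \<Longrightarrow> M *\<^sub>v 0\<^sub>v n = (0\<^sub>v n :: bit vec)"
  by (intro eq_vecI) auto

lemma mult_mat_vec_sum:
  assumes "M \<in> carrier_mat n n" "set us \<subseteq> carrier_vec n"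
  shows "vec_sum n (map ((*\<^sub>v) M) us) = M *\<^sub>v vec_sum n us"
  using assms(2) by (induction us) (use assms(1) in \<open>simp_all add: mult_mat_zero_vec mult_add_distrib_mat_vec[of _ n n]\<close>)

text \<open>A slice differs from its row only outside the index ranges that the event
  inspects.\<close>

lemma BR_event_slice:
  "(slice d {1..t} \<alpha> r a, slice d {1..<t} \<alpha> r b) \<in> BR_event n t A v \<longleftrightarrow>
     (\<lambda>i. a (\<alpha>, r, i), \<lambda>i. b (\<alpha>, r, i)) \<in> BR_event n t A v"
proof -
  have "map (slice d {1..t} \<alpha> r a) [1..<t+1] = map (\<lambda>i. a (\<alpha>, r, i)) [1..<t+1]"
    "map (slice d {1..<t} \<alpha> r b) [1..<t] = map (\<lambda>i. b (\<alpha>, r, i)) [1..<t]"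
    by (auto simp: slice_def)
  then have "BR_last n t (slice d {1..t} \<alpha> r a) (slice d {1..<t} \<alpha> r b) v
      = BR_last n t (\<lambda>i. a (\<alpha>, r, i)) (\<lambda>i. b (\<alpha>, r, i)) v"
    unfolding BR_last_def by (simp only:)
  then show ?thesis by (auto simp: slice_def)
qed

context warm_up
begin

lemma lin_comb_closed:
  assumes "set gs \<subseteq> carrier_vec n"
  shows "lin_comb \<alpha> gs \<in> carrier_vec n"
  unfolding lin_comb_def using assms by (intro vec_sum_closed) (auto dest!: set_zip_rightD)

lemma lin_comb_append:
  assumes "set gs \<subseteq> carrier_vec n" "g \<in> carrier_vec n" "length \<alpha> = length gs"
  shows "lin_comb (\<alpha> @ [c]) (gs @ [g]) = lin_comb \<alpha> gs + c \<cdot>\<^sub>v g"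
proof -
  have "set (map2 (\<lambda>c g. c \<cdot>\<^sub>v g) \<alpha> gs) \<subseteq> carrier_vec n"
    using assms(1) by (auto dest!: set_zip_rightD)
  then show ?thesis
    unfolding lin_comb_def using assms by (simp add: vec_sum_append)
qed

end

section \<open>The subspace \<open>W_G\<close> and its growth\<close>

locale warm_up_analysis = warm_up +
  fixes V :: "bit vec set" and \<epsilon> :: real
  assumes M: "M \<in> carrier_mat n n"
    and errorless: "\<And>z. z \<in> carrier_vec n \<Longrightarrow> Orc z = Some (M *\<^sub>v z) \<or> Orc z = None"
    and V: "BR_subspace n t \<epsilon> (agreement_set n M Orc) V"
    and n_pos: "1 \<le> n" and t_pos: "1 \<le> t"
    and eps: "0 \<le> \<epsilon>" "\<epsilon> \<le> 1"
begin

text \<open>\<open>covered gs\<close> is \<open>V + span gs\<close>, that is \<open>W\<^sub>G\<close> for the first components \<open>gs\<close> of \<open>G\<close>.\<close>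

definition covered :: "bit vec list \<Rightarrow> bit vec set" where
  "covered gs = foldl (\<lambda>U g. U \<union> (\<lambda>u. u + g) ` U) V gs"

lemma covered_simps [simp]:
  "covered [] = V" "covered (gs @ [g]) = covered gs \<union> (\<lambda>u. u + g) ` covered gs"
  by (simp_all add: covered_def)

lemma V_props: "V \<subseteq> carrier_vec n" "0\<^sub>v n \<in> V" "u \<in> V \<Longrightarrow> v \<in> V \<Longrightarrow> u + v \<in> V"
  using V unfolding BR_subspace_def subspace_def submodule_def by (auto simp: module_vec_simps)

lemma covered_closed: "set gs \<subseteq> carrier_vec n \<Longrightarrow> covered gs \<subseteq> carrier_vec n"
proof (induction gs rule: rev_induct)
  case (snoc g gs)
  then show ?case by (auto intro!: add_carrier_vec)
qed (simp add: V_props)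

text \<open>Because \<open>g + g\<close> vanishes, adjoining a single translate already yields
  closure: the four cases collapse to \<open>x + y\<close> and \<open>x + y + g\<close>.\<close>

lemma covered_add:
  assumes "set gs \<subseteq> carrier_vec n" "u \<in> covered gs" "v \<in> covered gs"
  shows "u + v \<in> covered gs"
  using assms
proof (induction gs arbitrary: u v rule: rev_induct)
  case (snoc g gs)
  then have g: "g \<in> carrier_vec n" and gs: "set gs \<subseteq> carrier_vec n" by auto
  note C = covered_closed[OF gs]
  have sh: "x + y + g = x + (y + g)" "x + g + y = x + y + g" "x + g + (y + g) = x + y"
    if "x \<in> covered gs" "y \<in> covered gs" for x y
  proof -
    have x: "x \<in> carrier_vec n" and y: "y \<in> carrier_vec n" using that C by auto
    show 1: "x + y + g = x + (y + g)" using x y g by (rule assoc_add_vec)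
    show 2: "x + g + y = x + y + g"
      using x y g by (simp add: assoc_add_vec[of _ n] comm_add_vec[of g n y])
    have "x + g + (y + g) = x + g + y + g"
      using x y g by (simp add: assoc_add_vec[of _ n])
    then show "x + g + (y + g) = x + y" using x y g 2 by simp
  qed
  have IH: "x + y \<in> covered gs" if "x \<in> covered gs" "y \<in> covered gs" for x y
    using snoc.IH[OF gs that] .
  obtain x b where u: "x \<in> covered gs" "u = x \<or> u = x + g" using snoc.prems(2) by auto
  obtain y c where v: "y \<in> covered gs" "v = y \<or> v = y + g" using snoc.prems(3) by auto
  have "u + v = x + y \<or> u + v = x + y + g"
    using u v sh[OF u(1) v(1)] by metis
  then show ?case using IH[OF u(1) v(1)] by auto
qed (simp add: V_props)

text \<open>The translate by \<open>g\<close> is disjoint from the subspace, as a common element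
  would put \<open>u + (u + g) = g\<close> into it.\<close>

lemma card_covered_snoc:
  assumes gs: "set gs \<subseteq> carrier_vec n" and g: "g \<in> carrier_vec n" "g \<notin> covered gs"
  shows "card (covered (gs @ [g])) = 2 * card (covered gs)"
proof -
  note C = covered_closed[OF gs]
  have fin: "finite (covered gs)" using C finite_bit_vecs finite_subset by blast
  have "inj_on (\<lambda>u. u + g) (covered gs)"
    using bij_betw_translation[OF g(1)] C by (auto intro: inj_on_subset simp: bij_betw_def)
  then have "card ((\<lambda>u. u + g) ` covered gs) = card (covered gs)" by (rule card_image)
  moreover have "covered gs \<inter> (\<lambda>u. u + g) ` covered gs = {}"
  proof (rule ccontr)
    assume "covered gs \<inter> (\<lambda>u. u + g) ` covered gs \<noteq> {}"
    then obtain u where u: "u \<in> covered gs" "u + g \<in> covered gs" by auto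
    then have "u + (u + g) \<in> covered gs" using covered_add[OF gs] by blast
    moreover have "u + (u + g) = g"
    proof -
      have uc: "u \<in> carrier_vec n" using u(1) C by blast
      then show ?thesis using g(1) bit_vec_add_self[OF uc] by (simp flip: assoc_add_vec[of _ n])
    qed
    ultimately show False using g(2) by simp
  qed
  ultimately show ?thesis using fin by (simp add: card_Un_disjoint)
qed

text \<open>Supplies the coefficient vector whose rows of the table can succeed. It depends on
  \<open>V\<close>, which is why the algorithm has to try all of them.\<close>

lemma covered_lin_comb:
  assumes "set gs \<subseteq> carrier_vec n" "u \<in> covered gs"
  shows "\<exists>\<alpha>. length \<alpha> = length gs \<and> u - lin_comb \<alpha> gs \<in> V"
  using assms
proof (induction gs arbitrary: u rule: rev_induct)
  case Nil
  then show ?case using V_props by (auto simp: lin_comb_def subset_iff)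
next
  case (snoc g gs)
  then have g: "g \<in> carrier_vec n" and gs: "set gs \<subseteq> carrier_vec n" by auto
  obtain x c where x: "x \<in> covered gs" "u = x + c \<cdot>\<^sub>v g"
  proof -
    consider "u \<in> covered gs" | x where "x \<in> covered gs" "u = x + g" using snoc.prems(2) by auto
    then show thesis
    proof cases
      case 1
      then have "u = u + 0 \<cdot>\<^sub>v g" using covered_closed[OF gs] g by (auto simp: subset_iff)
      then show thesis using that 1 by blast
    next
      case 2
      then show thesis using that[of x 1] by simp
    qed
  qed
  obtain \<alpha> where \<alpha>: "length \<alpha> = length gs" "x - lin_comb \<alpha> gs \<in> V"
    using snoc.IH[OF gs x(1)] by blast
  have "u - lin_comb (\<alpha> @ [c]) (gs @ [g]) = x - lin_comb \<alpha> gs"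
    unfolding lin_comb_append[OF gs g \<alpha>(1)] x(2)
    using lin_comb_closed[OF gs, of \<alpha>] covered_closed[OF gs] x(1) g
    by (intro bit_vec_add_diff_cancel[of _ n]) auto
  then show ?case using \<alpha> by (intro exI[of _ "\<alpha> @ [c]"]) simp
qed

section \<open>Exactness and success of a single candidate\<close>

definition valid :: "pairs \<Rightarrow> bool" where
  "valid G \<longleftrightarrow> (\<forall>(g, h)\<in>set G. g \<in> carrier_vec n \<and> h = M *\<^sub>v g)"

lemma valid_fst: "valid G \<Longrightarrow> set (map fst G) \<subseteq> carrier_vec n"
  by (auto simp: valid_def)

lemma lin_comb_valid:
  assumes "valid G" "length \<alpha> = length G"
  shows "lin_comb \<alpha> (map snd G) = M *\<^sub>v lin_comb \<alpha> (map fst G)"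
  using assms(2,1)
proof (induction \<alpha> G rule: list_induct2)
  case Nil
  then show ?case using M by (simp add: lin_comb_def mult_mat_zero_vec)
next
  case (Cons c \<alpha> gh G)
  then have "valid G" "fst gh \<in> carrier_vec n" "snd gh = M *\<^sub>v fst gh"
    by (auto simp: valid_def)
  moreover from this have "lin_comb \<alpha> (map fst G) \<in> carrier_vec n"
    using lin_comb_closed valid_fst by blast
  ultimately show ?case
    using Cons.IH M by (simp add: lin_comb_def mult_add_distrib_mat_vec[of _ n n] mult_mat_vec[of _ n n])
qed

text \<open>Demanded at every index: outside the table the default is the zero vector, so nothing is
  lost.\<close>

definition good_table :: "table \<Rightarrow> bool" where
  "good_table \<Omega> \<longleftrightarrow> (\<forall>x. fst \<Omega> x \<in> carrier_vec n \<and> snd \<Omega> x \<in> carrier_vec n)"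

lemma map_the_Orc:
  assumes "set zs \<subseteq> carrier_vec n" "None \<notin> set (map Orc zs)"
  shows "map the (map Orc zs) = map ((*\<^sub>v) M) zs"
  using assms errorless by (auto simp: image_iff) (metis option.sel subsetD)

text \<open>Answers other than \<bottom> are exact products, so by linearity the telescoping sum
  gives \<open>Mv\<close> for every coefficient vector and repetition, whether or not
  \<open>v - w\<close> lies in \<open>V\<close>.\<close>

lemma candidate_value_sound:
  assumes \<Omega>: "good_table \<Omega>" and G: "valid G" and v: "v \<in> carrier_vec n" and \<alpha>: "length \<alpha> = length G"
    and z: "candidate_value G \<Omega> v \<alpha> r = Some z"
  shows "z = M *\<^sub>v v"
proof -
  define as where "as = map (\<lambda>i. fst \<Omega> (\<alpha>, r, i)) [1..<t+1]"
  define bs where "bs = map (\<lambda>i. snd \<Omega> (\<alpha>, r, i)) [1..<t]"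
  define w where "w = lin_comb \<alpha> (map fst G)"
  define bt where "bt = vec_sum n as - vec_sum n bs - (v - w)"
  have as: "set as \<subseteq> carrier_vec n" and bs: "set bs \<subseteq> carrier_vec n"
    using \<Omega> by (auto simp: as_def bs_def good_table_def)
  have w: "w \<in> carrier_vec n" unfolding w_def by (rule lin_comb_closed[OF valid_fst[OF G]])
  note S = vec_sum_closed[OF as] vec_sum_closed[OF bs]
  have bt: "bt \<in> carrier_vec n" using S v w by (simp add: bt_def)
  have val: "candidate_value G \<Omega> v \<alpha> r = (if None \<in> set (map Orc as @ map Orc (bs @ [bt])) then None
      else Some (vec_sum n (map the (map Orc as)) - vec_sum n (map the (map Orc (bs @ [bt]))) + M *\<^sub>v w))"
    unfolding candidate_value_def BR_last_def as_def bs_def w_def bt_def Let_def lin_comb_valid[OF G \<alpha>] ..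
  then have ne: "None \<notin> set (map Orc as)" "None \<notin> set (map Orc (bs @ [bt]))"
    using z by (auto split: if_splits)
  have bsbt: "set (bs @ [bt]) \<subseteq> carrier_vec n" using bs bt by simp
  have "z = M *\<^sub>v vec_sum n as - M *\<^sub>v vec_sum n (bs @ [bt]) + M *\<^sub>v w"
    using z ne unfolding val map_the_Orc[OF as ne(1)] map_the_Orc[OF bsbt ne(2)]
      mult_mat_vec_sum[OF M as] mult_mat_vec_sum[OF M bsbt] by auto
  also have "vec_sum n (bs @ [bt]) = vec_sum n bs + bt"
    using bs bt by (simp add: vec_sum_append)
  also have "M *\<^sub>v vec_sum n as - M *\<^sub>v (vec_sum n bs + bt) + M *\<^sub>v w = M *\<^sub>v (vec_sum n as - (vec_sum n bs + bt) + w)"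
    using S bt w M by (simp add: mult_add_distrib_mat_vec[of _ n n] mult_minus_distrib_mat_vec[of _ n n])
  also have "vec_sum n as - (vec_sum n bs + bt) + w = v"
    unfolding bt_def by (rule bit_vec_telescope[OF S v w])
  finally show ?thesis .
qed

lemma candidate_value_complete:
  assumes "(\<lambda>i. fst \<Omega> (\<alpha>, r, i), \<lambda>i. snd \<Omega> (\<alpha>, r, i))
    \<in> BR_event n t (agreement_set n M Orc) (v - lin_comb \<alpha> (map fst G))"
  shows "candidate_value G \<Omega> v \<alpha> r \<noteq> None"
proof -
  let ?A = "agreement_set n M Orc"
  let ?as = "map (\<lambda>i. fst \<Omega> (\<alpha>, r, i)) [1..<t+1]"
  let ?bs = "map (\<lambda>i. snd \<Omega> (\<alpha>, r, i)) [1..<t] @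
    [BR_last n t (\<lambda>i. fst \<Omega> (\<alpha>, r, i)) (\<lambda>i. snd \<Omega> (\<alpha>, r, i)) (v - lin_comb \<alpha> (map fst G))]"
  have "None \<notin> Orc ` ?A" by (auto simp: agreement_set_def)
  moreover have "set ?as \<subseteq> ?A" "set ?bs \<subseteq> ?A"
    using assms by (auto simp del: upt_Suc)
  ultimately have "None \<notin> set (map Orc ?as @ map Orc ?bs)"
    unfolding set_append set_map by blast
  then show ?thesis
    unfolding candidate_value_def Let_def by (simp only: if_False option.distinct not_False_eq_True)
qed

section \<open>Failure of \<open>Correct\<close>, invariants of \<open>Repair\<close> and of the
  rounds\<close>

definition failure_prob :: ennreal where
  "failure_prob = ennreal ((1 - \<epsilon> ^ (2 * t + 1)) ^ R)"

lemma good_table_sample: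
  assumes "finite I" "finite J"
    and "\<Omega> \<in> set_pmf (pair_pmf (Pi_pmf I (0\<^sub>v n) (\<lambda>_. uniform_vec n)) (Pi_pmf J (0\<^sub>v n) (\<lambda>_. uniform_vec n)))"
  shows "good_table \<Omega>"
proof -
  have "carrier_vec n \<noteq> ({} :: bit vec set)" by (metis empty_iff zero_carrier_vec)
  then have "set_pmf (uniform_vec n) = carrier_vec n" by (simp add: uniform_vec_def)
  then show ?thesis
    using assms unfolding good_table_def
    by (auto simp: set_Pi_pmf PiE_dflt_def) (metis zero_carrier_vec)+
qed

text \<open>Outside \<open>W_G\<close> only exactness is claimed, and it holds in every execution.
  Inside, the suitable coefficient vector is determined before the table is drawn, so its
  \<open>R\<close> repetitions are independent trials.\<close>

lemma hoare_fresh_correct: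
  assumes G: "valid G" and v: "v \<in> carrier_vec n"
  shows "hoare failure_prob (fresh_correct G v)
    (\<lambda>y. (v \<in> covered (map fst G) \<longrightarrow> y \<noteq> None) \<and> (\<forall>z. y = Some z \<longrightarrow> z = M *\<^sub>v v))"
proof -
  let ?\<Phi> = "\<lambda>y. (v \<in> covered (map fst G) \<longrightarrow> y \<noteq> None) \<and> (\<forall>z. y = Some z \<longrightarrow> z = M *\<^sub>v v)"
  define I where "I = {\<alpha> :: bit list. length \<alpha> = length G} \<times> {1..R} \<times> {1..t}"
  define J where "J = {\<alpha> :: bit list. length \<alpha> = length G} \<times> {1..R} \<times> {1..<t}"
  define P where "P = pair_pmf (Pi_pmf I (0\<^sub>v n) (\<lambda>_. uniform_vec n)) (Pi_pmf J (0\<^sub>v n) (\<lambda>_. uniform_vec n))"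
  have fin: "finite I" "finite J" by (simp_all add: I_def J_def)
  have good: "good_table \<Omega>" if "\<Omega> \<in> set_pmf P" for \<Omega>
    using good_table_sample[OF fin] that by (simp add: P_def)
  have fresh: "fresh_correct G v = do { tick (n * (card I + card J)); \<Omega> \<leftarrow> sample P; correct G \<Omega> v }"
    by (simp add: fresh_correct_def sample_table_def I_def J_def P_def bind_comp_assoc)
  have sound: "z = M *\<^sub>v v" if "\<Omega> \<in> set_pmf P" "(Some z, c) \<in> set_pmf (run (correct G \<Omega> v))" for \<Omega> z c
    using alwaysD[OF always_correct[OF n_pos t_pos] that(2)] candidate_value_sound[OF good[OF that(1)] G v] by blast
  show ?thesis
  proof (cases "v \<in> covered (map fst G)")
    case False
    have "always (fresh_correct G v) (\<lambda>y c. ?\<Phi> y)"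
      unfolding fresh always_charge_bind
      by (rule always_bind[where P = "\<lambda>\<Omega> c. \<Omega> \<in> set_pmf P"]) (use False sound in \<open>auto simp: always_def\<close>)
    then show ?thesis by (rule hoare_always)
  next
    case True
    obtain \<alpha> where \<alpha>: "length \<alpha> = length G" "v - lin_comb \<alpha> (map fst G) \<in> V"
      using covered_lin_comb[OF valid_fst[OF G] True] by auto
    let ?Ev = "BR_event n t (agreement_set n M Orc) (v - lin_comb \<alpha> (map fst G))"
    let ?bad = "{(a, b). \<forall>r\<in>{1..R}. (slice (0\<^sub>v n) {1..t} \<alpha> r a, slice (0\<^sub>v n) {1..<t} \<alpha> r b) \<in> - ?Ev}"
    let ?p = "pair_pmf (Pi_pmf {1..t} (0\<^sub>v n) (\<lambda>_. uniform_vec n)) (Pi_pmf {1..<t} (0\<^sub>v n) (\<lambda>_. uniform_vec n))"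
    have bad: "\<Omega> \<in> ?bad" if "\<Omega> \<in> set_pmf P" "(y, c) \<in> set_pmf (run (correct G \<Omega> v))" "\<not> ?\<Phi> y" for \<Omega> y c
    proof -
      have "y = None" using that sound by (cases y) auto
      then have none: "candidate_value G \<Omega> v \<alpha> r = None" if "r \<in> {1..R}" for r
        using alwaysD[OF always_correct[OF n_pos t_pos] \<open>(y, c) \<in> _\<close>] \<alpha>(1) that by blast
      have "(slice (0\<^sub>v n) {1..t} \<alpha> r (fst \<Omega>), slice (0\<^sub>v n) {1..<t} \<alpha> r (snd \<Omega>)) \<notin> ?Ev" if r: "r \<in> {1..R}" for r
      proof
        assume "(slice (0\<^sub>v n) {1..t} \<alpha> r (fst \<Omega>), slice (0\<^sub>v n) {1..<t} \<alpha> r (snd \<Omega>)) \<in> ?Ev"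
        then have "candidate_value G \<Omega> v \<alpha> r \<noteq> None"
          unfolding BR_event_slice by (rule candidate_value_complete)
        with none[OF r] show False by contradiction
      qed
      then show ?thesis by (cases \<Omega>) auto
    qed
    have "(\<integral>\<^sup>+(y, c). of_bool (\<not> ?\<Phi> y) \<partial>run (fresh_correct G v))
        = (\<integral>\<^sup>+\<Omega>. (\<integral>\<^sup>+(y, c). of_bool (\<not> ?\<Phi> y) \<partial>run (correct G \<Omega> v)) \<partial>P)"
      unfolding fresh by (simp add: bind_return_pmf bind_map_pmf case_prod_beta')
    also have "\<dots> \<le> (\<integral>\<^sup>+\<Omega>. indicator ?bad \<Omega> \<partial>P)"
    proof (intro nn_integral_mono_AE, unfold AE_measure_pmf_iff, intro ballI)
      fix \<Omega> assume \<Omega>: "\<Omega> \<in> set_pmf P"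
      have "(\<integral>\<^sup>+(y, c). of_bool (\<not> ?\<Phi> y) \<partial>run (correct G \<Omega> v)) \<le> (\<integral>\<^sup>+z. indicator ?bad \<Omega> \<partial>run (correct G \<Omega> v))"
      proof (rule nn_integral_mono_AE, unfold AE_measure_pmf_iff, rule ballI)
        fix z assume z: "z \<in> set_pmf (run (correct G \<Omega> v))"
        obtain y c where yc: "z = (y, c)" by (cases z)
        show "(case z of (y, c) \<Rightarrow> of_bool (\<not> ?\<Phi> y)) \<le> (indicator ?bad \<Omega> :: ennreal)"
        proof (cases "?\<Phi> y")
          case True
          then have "\<not> \<not> ?\<Phi> y" by blast
          then show ?thesis unfolding yc prod.case of_bool_def by (simp only: if_False zero_le)
        next
          case False
          with bad[OF \<Omega> z[unfolded yc]] have "\<Omega> \<in> ?bad" by blast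
          then show ?thesis unfolding yc prod.case by (simp only: indicator_simps of_bool_def) simp
        qed
      qed
      then show "(\<integral>\<^sup>+(y, c). of_bool (\<not> ?\<Phi> y) \<partial>run (correct G \<Omega> v)) \<le> indicator ?bad \<Omega>"
        by simp
    qed
    also have "\<dots> = emeasure (measure_pmf P) ?bad" by simp
    also have "\<dots> = emeasure (measure_pmf ?p) (- ?Ev) ^ card {1..R}"
      unfolding P_def I_def J_def using \<alpha>(1) by (intro emeasure_all_slices) auto
    also have "\<dots> = ennreal ((1 - measure_pmf.prob ?p ?Ev) ^ R)"
      using measure_pmf.prob_compl[of ?Ev ?p]
      by (simp add: measure_pmf.emeasure_eq_measure ennreal_power Compl_eq_Diff_UNIV)
    also have "\<dots> \<le> failure_prob"
      unfolding failure_prob_def using V \<alpha>(2)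
      by (intro ennreal_leI power_mono) (auto simp: BR_subspace_def)
    \<comment> \<open>There is exactly one call in every execution, so the expectation equals
      one.\<close>
    also have "\<dots> = failure_prob * (\<integral>\<^sup>+(y, c). of_nat (correct_calls c) \<partial>run (fresh_correct G v))"
    proof -
      have "(\<integral>\<^sup>+(y, c). of_nat (correct_calls c) \<partial>run (fresh_correct G v)) = (\<integral>\<^sup>+z. 1 \<partial>run (fresh_correct G v))"
        using always_fresh_correct[OF n_pos t_pos order_refl, of G v]
        by (intro nn_integral_cong_AE) (auto simp: AE_measure_pmf_iff always_def)
      then show ?thesis by simp
    qed
    finally show ?thesis by (simp add: hoare_def)
  qed
qed

text \<open>Without failures, \<bottom> on a half shows that this half lies outside
  \<open>W_G\<close>, as the recursive call requires. If both halves are answered, the sum of the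
  exact answers belongs to \<open>v\<close>, which is outside by assumption. \<open>G\<close> is
  unchanged until the final append.\<close>

lemma hoare_repair:
  assumes G: "valid G" and v: "v \<in> carrier_vec n" "v \<notin> covered (map fst G)"
  shows "hoare failure_prob (repair G v)
    (\<lambda>G'. valid G' \<and> (\<exists>g h. G' = G @ [(g, h)] \<and> g \<notin> covered (map fst G)))"
  using v
proof (induction "wt v" arbitrary: v rule: less_induct)
  case less
  let ?\<Phi> = "\<lambda>G'. valid G' \<and> (\<exists>g h. G' = G @ [(g, h)] \<and> g \<notin> covered (map fst G))"
  have snoc: "?\<Phi> (G @ [(v, M *\<^sub>v v)])"
    using G less.prems by (auto simp: valid_def)
  show ?case
  proof (cases "wt v \<le> 1")
    case True
    have "always (direct v) (\<lambda>h c. h = M *\<^sub>v v)"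
      by (rule always_mono[OF always_direct]) (use M less.prems True in auto)
    then have "always (repair G v) (\<lambda>G' c. ?\<Phi> G')"
      unfolding repair_eq[of G v] if_P[OF True] always_charge_bind
      by (rule always_bind) (use snoc in simp)
    then show ?thesis by (rule hoare_always)
  next
    case False
    define v0 where "v0 = fst (split v)"
    define v1 where "v1 = snd (split v)"
    have sp: "dim_vec v0 = dim_vec v" "dim_vec v1 = dim_vec v" "v = v0 + v1"
      "wt v0 < wt v" "wt v1 < wt v"
      using halving[unfolded halving_def, rule_format, of v] False
      by (auto simp: case_prod_beta v0_def v1_def)
    have car: "v0 \<in> carrier_vec n" "v1 \<in> carrier_vec n"
      by (rule carrier_vecI, simp only: sp(1,2) carrier_vecD[OF less.prems(1)])+
    have "v0 \<notin> covered (map fst G) \<or> v1 \<notin> covered (map fst G)"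
      using covered_add[OF valid_fst[OF G]] sp(3) less.prems(2) by blast
    show ?thesis
      unfolding repair_eq[of G v] if_not_P[OF False] v0_def[symmetric] v1_def[symmetric]
    proof (rule hoare_charge_bind, rule hoare_bind[OF hoare_fresh_correct[OF G car(1)]],
        rule hoare_bind[OF hoare_fresh_correct[OF G car(2)]], rule hoare_charge_bind)
      fix y0 y1
      assume y0: "(v0 \<in> covered (map fst G) \<longrightarrow> y0 \<noteq> None) \<and> (\<forall>z. y0 = Some z \<longrightarrow> z = M *\<^sub>v v0)"
        and y1: "(v1 \<in> covered (map fst G) \<longrightarrow> y1 \<noteq> None) \<and> (\<forall>z. y1 = Some z \<longrightarrow> z = M *\<^sub>v v1)"
      have h0: "hoare failure_prob (repair G v0) ?\<Phi>" if "y0 = None"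
        using less.hyps[OF sp(4) car(1)] y0 that by blast
      have h1: "hoare failure_prob (repair G v1) ?\<Phi>" if "y1 = None"
        using less.hyps[OF sp(5) car(2)] y1 that by blast
      have h2: "hoare failure_prob (do { y \<leftarrow> add (the y0) (the y1); tick (2 * n); ret (G @ [(v, y)]) }) ?\<Phi>"
        if "y0 \<noteq> None" "y1 \<noteq> None"
      proof (rule hoare_always, unfold always_basic_bind always_charge_bind always_ret)
        have "the y0 + the y1 = M *\<^sub>v v"
          using y0 y1 that car M unfolding sp(3) by (auto simp: mult_add_distrib_mat_vec[of _ n n])
        then show "?\<Phi> (G @ [(v, the y0 + the y1)])" using snoc by simp
      qed
      show "hoare failure_prob (if y0 = None then repair G v0 else if y1 = None then repair G v1
         else do { y \<leftarrow> add (the y0) (the y1); tick (2 * n); ret (G @ [(v, y)]) }) ?\<Phi>"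
        using h0 h1 h2 by (simp only: split: if_split) blast
    qed
  qed
qed

text \<open>The product of the cardinality and \<open>2 ^ k\<close> is a potential: a round without
  output doubles the cardinality and lowers \<open>k\<close> by one. At \<open>k = 0\<close> the
  subspace would exceed the whole space, so the rounds cannot run out.\<close>

lemma hoare_rounds:
  assumes "valid G" and x: "x \<in> carrier_vec n" and "2 ^ n < card (covered (map fst G)) * 2 ^ k"
  shows "hoare failure_prob (rounds k G x) (\<lambda>y. y = Some (M *\<^sub>v x))"
  using assms(1,3)
proof (induction k arbitrary: G)
  case 0
  have "card (covered (map fst G)) \<le> 2 ^ n"
    using card_mono[OF finite_bit_vecs covered_closed[OF valid_fst[OF 0(1)]]] by (simp add: card_bit_vecs)
  then show ?case using 0 by simp
next
  case (Suc k)
  show ?case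
    unfolding rounds_Suc
  proof (rule hoare_bind[OF hoare_fresh_correct[OF Suc.prems(1) x]], rule hoare_charge_bind)
    fix y
    assume y: "(x \<in> covered (map fst G) \<longrightarrow> y \<noteq> None) \<and> (\<forall>z. y = Some z \<longrightarrow> z = M *\<^sub>v x)"
    show "hoare failure_prob (if y \<noteq> None then do { tick n; ret y } else do { G' \<leftarrow> repair G x; rounds k G' x })
      (\<lambda>y. y = Some (M *\<^sub>v x))"
    proof (cases "y = None")
      case False
      then show ?thesis using y by (auto intro!: hoare_charge_bind hoare_ret)
    next
      case True
      then have "x \<notin> covered (map fst G)" using y by blast
      note rep = hoare_repair[OF Suc.prems(1) x this]
      have "hoare failure_prob (do { G' \<leftarrow> repair G x; rounds k G' x }) (\<lambda>y. y = Some (M *\<^sub>v x))"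
      proof (rule hoare_bind[OF rep], elim conjE exE)
        fix G' g h
        assume G': "valid G'" "G' = G @ [(g, h)]" "g \<notin> covered (map fst G)"
        then have "g \<in> carrier_vec n" by (simp add: valid_def)
        then have "card (covered (map fst G')) = 2 * card (covered (map fst G))"
          using card_covered_snoc[OF valid_fst[OF Suc.prems(1)] _ G'(3)] by (simp add: G'(2) del: covered_simps)
        then show "hoare failure_prob (rounds k G' x) (\<lambda>y. y = Some (M *\<^sub>v x))"
          using Suc.prems(2) by (intro Suc.IH[OF G'(1)]) simp
      qed
      with True show ?thesis by simp
    qed
  qed
qed

end

context warm_up
begin

lemma always_warmup_cost:
  assumes "1 \<le> n" "1 \<le> t" "x \<in> carrier_vec n"
  shows "always (warmup L x) (\<lambda>y c. oracle_calls c \<le> correct_calls c * oracle_bound L \<and>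
    entry_queries c \<le> L * n \<and> correct_calls c \<le> L * (1 + 2 * nat \<lceil>log 2 (real n)\<rceil>) \<and>
    steps c \<le> correct_calls c * (2 * step_bound L))"
proof -
  have "real n = 2 powr log 2 (real n)" using assms(1) by simp
  also have "\<dots> \<le> 2 powr real (nat \<lceil>log 2 (real n)\<rceil>)"
    by (intro powr_mono) (auto simp: real_nat_ceiling_ge)
  also have "\<dots> = real (2 ^ nat \<lceil>log 2 (real n)\<rceil>)" by (simp add: powr_realpow)
  finally have "n \<le> 2 ^ nat \<lceil>log 2 (real n)\<rceil>" by (simp only: of_nat_le_iff)
  then have "wt x \<le> 2 ^ nat \<lceil>log 2 (real n)\<rceil>" using wt_le[OF assms(3)] by linarith
  from always_rounds_cost[OF assms(1,2) this, of "[]" L L] show ?thesis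
    by (simp add: warmup_def)
qed

end

context warm_up_analysis
begin

lemma prob_warmup:
  assumes L: "codim n V < L" and x: "x \<in> carrier_vec n"
    and Q: "always (warmup L x) (\<lambda>y c. correct_calls c \<le> Q)"
    and p: "(1 - \<epsilon> ^ (2 * t + 1)) ^ R * real Q \<le> 1 / 3"
  shows "2 / 3 \<le> measure_pmf.prob (run (warmup L x)) {(y, s). y = Some (M *\<^sub>v x)}"
proof -
  let ?P = "run (warmup L x)" and ?S = "{(y, s). y = Some (M *\<^sub>v x)}"
  have sub: "VectorSpace.subspace class_ring V (module_vec TYPE(bit) n)"
    using V by (simp add: BR_subspace_def)
  \<comment> \<open>Strictness in \<open>codim n V < L\<close> leaves one round for the output after
    \<open>W_G\<close> has filled the space.\<close>
  have "(2 :: nat) ^ n < card V * 2 ^ L"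
    unfolding card_subspace[OF sub] power_add[symmetric] using L by (simp add: codim_def)
  then have "hoare failure_prob (warmup L x) (\<lambda>y. y = Some (M *\<^sub>v x))"
    unfolding warmup_def by (intro hoare_rounds x) (auto simp: valid_def)
  then have "(\<integral>\<^sup>+(y, c). of_bool (y \<noteq> Some (M *\<^sub>v x)) \<partial>?P)
      \<le> failure_prob * (\<integral>\<^sup>+(y, c). of_nat (correct_calls c) \<partial>?P)"
    by (simp add: hoare_def)
  also have "(\<integral>\<^sup>+(y, c). of_bool (y \<noteq> Some (M *\<^sub>v x)) \<partial>?P) = (\<integral>\<^sup>+z. indicator (- ?S) z \<partial>?P)"
    by (intro nn_integral_cong) (auto simp: indicator_def)
  also have "\<dots> = ennreal (measure_pmf.prob ?P (- ?S))"
    by (simp add: measure_pmf.emeasure_eq_measure)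
  also have "failure_prob * (\<integral>\<^sup>+(y, c). of_nat (correct_calls c) \<partial>?P) \<le> failure_prob * (\<integral>\<^sup>+z. of_nat Q \<partial>?P)"
    using Q by (intro mult_left_mono nn_integral_mono_AE) (auto simp: AE_measure_pmf_iff always_def)
  also have "\<dots> = ennreal ((1 - \<epsilon> ^ (2 * t + 1)) ^ R * real Q)"
    using eps by (simp add: failure_prob_def ennreal_mult power_le_one mult_le_one flip: ennreal_of_nat_eq_real_of_nat)
  also have "\<dots> \<le> ennreal (1 / 3)" using p by (rule ennreal_leI)
  finally have "measure_pmf.prob ?P (- ?S) \<le> 1 / 3"
    by (subst (asm) ennreal_le_iff) auto
  then show ?thesis
    using measure_pmf.prob_compl[of ?S ?P] by (simp add: Compl_eq_Diff_UNIV)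
qed

end

section \<open>Parameters\<close>

text \<open>\<open>R\<close> is chosen such that \<open>q * R\<close> is at least
  \<open>2 * ln (Q + 2)\<close>, hence one call fails with probability at most the inverse square of
  \<open>Q + 2\<close>. The square leaves room for the factor \<open>Q\<close>; this is the origin
  of \<open>2 \<le> C\<close>.\<close>

lemma failure_le_third:
  fixes C \<epsilon> :: real
  assumes \<epsilon>: "0 < \<epsilon>" "\<epsilon> \<le> 1" and C: "2 \<le> C"
  shows "(1 - \<epsilon> ^ (2 * t + 1)) ^ repetitions C \<epsilon> t Q * real Q \<le> 1 / 3"
proof -
  define q where "q = \<epsilon> ^ (2 * t + 1)"
  define R where "R = repetitions C \<epsilon> t Q"
  have q: "0 < q" "q \<le> 1"
    unfolding q_def using \<epsilon> by (intro zero_less_power power_le_one; simp)+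
  have "C * (1 / q) * log 2 (real Q + 2) \<le> real R"
    using real_nat_ceiling_ge by (simp add: R_def repetitions_def q_def power_one_over)
  then have "C * log 2 (real Q + 2) \<le> q * real R"
    using q by (simp add: field_simps)
  moreover have "2 * ln (real Q + 2) \<le> C * log 2 (real Q + 2)"
  proof (intro mult_mono C)
    have "ln (real Q + 2) * ln 2 \<le> ln (real Q + 2) * 1"
      using ln_2_less_1 by (intro mult_left_mono) auto
    then show "ln (real Q + 2) \<le> log 2 (real Q + 2)" by (simp add: log_def field_simps)
  qed (use C in auto)
  ultimately have exponent: "2 * ln (real Q + 2) \<le> q * real R" by linarith
  have "(1 - q) ^ R \<le> exp (- q) ^ R"
    using q exp_ge_add_one_self[of "- q"] by (intro power_mono) auto
  also have "\<dots> = exp (- (q * real R))" by (simp add: exp_of_nat_mult[symmetric] mult.commute)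
  also have "\<dots> \<le> exp (- (2 * ln (real Q + 2)))" using exponent by simp
  also have "\<dots> = 1 / (real Q + 2)\<^sup>2"
    by (simp add: exp_minus exp_double field_simps)
  finally have "(1 - q) ^ R * real Q \<le> 1 / (real Q + 2)\<^sup>2 * real Q"
    by (intro mult_right_mono) auto
  also have "\<dots> \<le> 1 / 3"
  proof -
    have "3 * real Q \<le> (real Q + 2)\<^sup>2" by (simp add: power2_sum)
    then show ?thesis by (simp add: pos_divide_le_eq)
  qed
  finally show ?thesis by (simp add: q_def R_def)
qed

text \<open>With \<open>y\<close> the product of the two logarithms, the polynomial factors are at
  most \<open>b\<^sup>2 * y\<close>, \<open>5 * b ^ 3 * y * E\<close> and
  \<open>68 * (b * y)\<close>, whence 340, the sixth power of \<open>b\<close> and the exponent 3.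
  In \<open>L + (2 * t + 1)\<close> the summands take one, two and one multiples of
  \<open>b * l\<close>, whence \<open>4 * b\<close>.\<close>

lemma cost_factor_le_soft_bound:
  fixes b C \<epsilon> :: real
  assumes b: "1 \<le> b" "C \<le> b" "0 \<le> C" and \<epsilon>: "0 < \<epsilon>" "\<epsilon> \<le> 1 / 2" and n: "1 \<le> n"
    and t: "real t \<le> b * log 2 (1 / \<epsilon>)" and L: "real L \<le> b * log 2 (1 / \<epsilon>)"
    and Q: "real Q \<le> b * real L * log 2 (real n + 1)"
  shows "real Q * 2 ^ L * (real (repetitions C \<epsilon> t Q) + 1) * (10 * real L + 18 * real t + 40)
    \<le> soft_bound (340 * b ^ 6) (4 * b) 3 n \<epsilon>"
proof -
  define l where "l = log 2 (1 / \<epsilon>)"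
  define N where "N = log 2 (real n + 1)"
  define y where "y = N * l"
  define E where "E = (1 / \<epsilon>) ^ (2 * t + 1)"
  define R where "R = real (repetitions C \<epsilon> t Q)"
  have l: "1 \<le> l" using \<epsilon> by (simp add: l_def le_log_iff field_simps)
  have N: "1 \<le> N" using n by (simp add: N_def le_log_iff)
  have y: "1 \<le> y" "l \<le> y" using mult_mono[OF N l] mult_right_mono[OF N, of l] l N by (auto simp: y_def)
  have E: "1 \<le> E" unfolding E_def using \<epsilon> by (intro one_le_power) (simp add: field_simps)
  have by1: "1 \<le> b * y" using mult_mono[OF b(1) y(1)] b y by simp
  have Ly: "real L \<le> b * y" and ty: "real t \<le> b * y"
    using L t mult_left_mono[OF y(2), of b] b(1) unfolding l_def by linarith+
  have "real Q \<le> b * (b * l) * N"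
    using Q L b N by (auto simp: l_def[symmetric] N_def[symmetric] intro: order_trans mult_right_mono mult_left_mono)
  then have Qy: "real Q \<le> b\<^sup>2 * y" by (simp add: y_def power2_eq_square mult_ac)
  have b2y: "1 \<le> b\<^sup>2 * y" using mult_mono[OF b(1) by1] b by1 by (simp add: power2_eq_square mult_ac)
  \<comment> \<open>Such a crude estimate suffices because \<open>Q\<close> itself is
    polylogarithmic.\<close>
  have "log 2 (real Q + 2) \<le> real Q + 2"
    using log2_of_power_le[of "Q + 2" "Q + 2"] less_exp[of "Q + 2"] by (simp add: add.commute)
  then have logQ: "log 2 (real Q + 2) \<le> 3 * (b\<^sup>2 * y)" using Qy b2y by linarith
  have Ry: "R + 1 \<le> 5 * b ^ 3 * y * E"
  proof -
    have "0 \<le> C * E * log 2 (real Q + 2)" using b E by simp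
    then have "R \<le> C * E * log 2 (real Q + 2) + 1"
      unfolding R_def repetitions_def E_def by linarith
    also have "\<dots> \<le> b * E * (3 * (b\<^sup>2 * y)) + 1"
      using b E logQ by (intro add_right_mono mult_mono) auto
    finally have 1: "R + 1 \<le> 3 * (b ^ 3 * y * E) + 2" by (simp add: power2_eq_square power3_eq_cube mult_ac)
    have "1 * 1 \<le> b\<^sup>2 * y * (b * E)"
      using b2y mult_mono[OF b(1) E] b E by (intro mult_mono) auto
    then have "1 \<le> b ^ 3 * y * E" by (simp add: power2_eq_square power3_eq_cube mult_ac)
    with 1 show ?thesis by linarith
  qed
  have sum: "10 * real L + 18 * real t + 40 \<le> 68 * (b * y)"
    using Ly ty by1 by linarith
  have expo: "2 ^ L * E \<le> (2 / \<epsilon>) powr (4 * b * l)"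
  proof -
    have "2 ^ L * E \<le> (2 / \<epsilon>) ^ L * (2 / \<epsilon>) ^ (2 * t + 1)"
      unfolding E_def using \<epsilon> by (intro mult_mono power_mono) (auto simp: field_simps)
    also have "\<dots> = (2 / \<epsilon>) ^ (L + (2 * t + 1))"
      by (rule power_add[symmetric])
    also have "\<dots> = (2 / \<epsilon>) powr real (L + (2 * t + 1))"
      using \<epsilon> by (intro powr_realpow[symmetric]) simp
    also have "\<dots> = (2 / \<epsilon>) powr (real L + (2 * real t + 1))" by (simp add: add_ac)
    also have "\<dots> \<le> (2 / \<epsilon>) powr (4 * b * l)"
    proof (intro powr_mono)
      have "1 \<le> b * l" using mult_mono[OF b(1) l] b l by simp
      then show "real L + (2 * real t + 1) \<le> 4 * b * l"
        using L t by (simp add: l_def[symmetric])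
    qed (use \<epsilon> in \<open>simp add: field_simps\<close>)
    finally show ?thesis .
  qed
  have R0: "0 \<le> R" by (simp add: R_def)
  have "real Q * 2 ^ L * (R + 1) * (10 * real L + 18 * real t + 40)
      \<le> (b\<^sup>2 * y) * 2 ^ L * (5 * b ^ 3 * y * E) * (68 * (b * y))"
    using Qy Ry sum R0 b y E by (intro mult_mono) auto
  also have "\<dots> = 340 * b ^ 6 * (2 ^ L * E) * y ^ 3"
    by (simp add: power2_eq_square eval_nat_numeral mult_ac)
  also have "\<dots> \<le> 340 * b ^ 6 * (2 / \<epsilon>) powr (4 * b * l) * y ^ 3"
    using expo b y by (intro mult_right_mono mult_left_mono) auto
  finally show ?thesis
    by (simp add: soft_bound_def R_def y_def l_def N_def)
qed

text \<open>In \<open>18 * t\<close>, the part \<open>16 * t\<close> comes from twice the step bound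
  and \<open>2 * t\<close> from the oracle calls of a candidate. Since \<open>n \<le> T\<close>,
  steps and oracle calls are both measured in units of \<open>T\<close>.\<close>

lemma warmup_total_cost:
  fixes T :: real
  assumes w: "warm_up split pick" and n: "1 \<le> n" and t: "1 \<le> t"
    and x: "x \<in> carrier_vec n"
    and ys: "(y, s) \<in> set_pmf (run (warm_up.warmup n M Orc t R split pick L x))" and Q: "correct_calls s \<le> Q"
  defines "X \<equiv> real Q * 2 ^ L * (real R + 1) * (10 * real L + 18 * real t + 40)"
  shows "real (oracle_calls s) \<le> X" and "entry_queries s \<le> L * n"
    and "real n \<le> T \<Longrightarrow> running_time T s \<le> X * T"
proof -
  interpret warm_up n M Orc t R split pick by (rule w)
  note cost = alwaysD[OF always_warmup_cost[OF n t x] ys]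
  then show "entry_queries s \<le> L * n" by blast
  define B where "B = real Q * 2 ^ L * (real R + 1)"
  have B: "0 \<le> B" by (simp add: B_def)
  have X: "X = B * (10 * real L + 18 * real t + 40)" by (simp add: X_def B_def)
  have "oracle_calls s \<le> Q * oracle_bound L"
    using cost mult_le_mono1[OF Q, of "oracle_bound L"] by linarith
  then have "real (oracle_calls s) \<le> real (Q * oracle_bound L)" by (simp only: of_nat_le_iff)
  also have "\<dots> = real Q * 2 ^ L * real R * (2 * real t)" by (simp add: oracle_bound_def)
  also have "\<dots> \<le> B * (2 * real t)"
    unfolding B_def by (intro mult_right_mono mult_left_mono) auto
  finally have oc: "real (oracle_calls s) \<le> B * (2 * real t)" .
  also have "\<dots> \<le> X" unfolding X using B by (intro mult_left_mono) auto
  finally show "real (oracle_calls s) \<le> X" .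
  have "steps s \<le> Q * (2 * step_bound L)"
    using cost mult_le_mono1[OF Q, of "2 * step_bound L"] by linarith
  then have "real (steps s) \<le> real (Q * (2 * step_bound L))" by (simp only: of_nat_le_iff)
  also have "\<dots> = B * (10 * real L + 16 * real t + 40) * real n"
    by (simp add: step_bound_def B_def algebra_simps)
  finally have st: "real (steps s) \<le> B * (10 * real L + 16 * real t + 40) * real n" .
  show "running_time T s \<le> X * T" if T: "real n \<le> T"
  proof -
    have "0 \<le> T" using T by simp
    then have "T * real (oracle_calls s) \<le> T * (B * (2 * real t))" using oc by (rule mult_left_mono[rotated])
    moreover have "B * (10 * real L + 16 * real t + 40) * real n \<le> B * (10 * real L + 16 * real t + 40) * T"
      using T B by (intro mult_left_mono) auto
    ultimately have "running_time T s \<le> T * (B * (2 * real t)) + B * (10 * real L + 16 * real t + 40) * T"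
      using st unfolding running_time_def by linarith
    also have "\<dots> = X * T" by (simp add: X algebra_simps)
    finally show ?thesis .
  qed
qed

text \<open>One call per round and two per level of halving; \<open>R\<close> does not occur, so it
  may be chosen afterwards. The single call and the rounding of the logarithm add at most 3, which
  is at most three times \<open>log 2 (n + 1)\<close>, whence the constant 5.\<close>

lemma bounds_correct_calls_exists:
  assumes w: "warm_up split pick" and n: "1 \<le> n" and t: "1 \<le> t" and x: "x \<in> carrier_vec n"
  shows "\<exists>Q. bounds_correct_calls n M Orc t split pick L x Q \<and> real Q \<le> 5 * real L * log 2 (real n + 1)"
proof (intro exI conjI)
  let ?k = "nat \<lceil>log 2 (real n)\<rceil>"
  show "bounds_correct_calls n M Orc t split pick L x (L * (1 + 2 * ?k))"
    unfolding bounds_correct_calls_def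
  proof (intro allI ballI, clarify)
    fix R y s
    interpret warm_up n M Orc t R split pick by (rule w)
    assume "(y, s) \<in> set_pmf (run (warmup L x))"
    from alwaysD[OF always_warmup_cost[OF n t x] this] show "correct_calls s \<le> L * (1 + 2 * ?k)" by blast
  qed
  have "0 \<le> log 2 (real n)" using n by simp
  then have "real ?k \<le> log 2 (real n) + 1" by linarith
  moreover have "log 2 (real n) \<le> log 2 (real n + 1)" using n by simp
  moreover have "1 \<le> log 2 (real n + 1)" using n by (simp add: le_log_iff)
  ultimately have "1 + 2 * real ?k \<le> 5 * log 2 (real n + 1)" by linarith
  then have "real L * (1 + 2 * real ?k) \<le> real L * (5 * log 2 (real n + 1))" by (intro mult_left_mono) auto
  then show "real (L * (1 + 2 * ?k)) \<le> 5 * real L * log 2 (real n + 1)" by (simp add: algebra_simps)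
qed

lemma agreement_set_density:
  assumes "errorless_with_agreement n M Orc \<epsilon>"
  shows "\<epsilon> \<le> card (agreement_set n M Orc) / 2 ^ n"
proof -
  have "carrier_vec n \<noteq> ({} :: bit vec set)" by (metis empty_iff zero_carrier_vec)
  then have "measure_pmf.prob (uniform_vec n) {z. Orc z = Some (M *\<^sub>v z)}
      = card (carrier_vec n \<inter> {z. Orc z = Some (M *\<^sub>v z)}) / 2 ^ n"
    by (simp add: uniform_vec_def measure_pmf_of_set card_bit_vecs)
  also have "carrier_vec n \<inter> {z. Orc z = Some (M *\<^sub>v z)} = agreement_set n M Orc"
    by (auto simp: agreement_set_def)
  finally show ?thesis using assms by (simp add: errorless_with_agreement_def)
qed

theorem theorem2p4:
  shows "\<exists>K_V K_Q C0 :: real. \<forall>c_t c_L c_Q C :: real. C0 \<le> C \<longrightarrow>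
    (\<exists>(c :: real) (a :: real) (k :: nat).
      \<forall>(n :: nat) (M :: bit mat) (\<epsilon> :: real) (Orc :: bit vec \<Rightarrow> bit vec option) (t :: nat).
        1 \<le> n \<longrightarrow> M \<in> carrier_mat n n \<longrightarrow> 0 < \<epsilon> \<longrightarrow> \<epsilon> \<le> 1 / 2 \<longrightarrow>
        errorless_with_agreement n M Orc \<epsilon> \<longrightarrow>
        1 / 2 * log 2 (1 / \<epsilon>) + 1 \<le> real t \<longrightarrow> real t \<le> c_t * log 2 (1 / \<epsilon>) \<longrightarrow>
        (\<exists>V. BR_subspace n t \<epsilon> (agreement_set n M Orc) V \<and>
             real (codim n V) \<le> K_V * log 2 (1 / \<epsilon>) \<and>
          (\<forall>L split pick x.
            codim n V < L \<longrightarrow> real L \<le> c_L * log 2 (1 / \<epsilon>) \<longrightarrow>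
            halving split \<longrightarrow> selecting pick \<longrightarrow> x \<in> carrier_vec n \<longrightarrow>
            (\<exists>Q. bounds_correct_calls n M Orc t split pick L x Q \<and>
                 real Q \<le> K_Q * real L * log 2 (real n + 1)) \<and>
            (\<forall>Q. bounds_correct_calls n M Orc t split pick L x Q \<longrightarrow>
                 real Q \<le> c_Q * real L * log 2 (real n + 1) \<longrightarrow>
              (let P = run (warm_up.warmup n M Orc t (repetitions C \<epsilon> t Q) split pick L x) in
                 measure_pmf.prob P {(y, s). y = Some (M *\<^sub>v x)} \<ge> 2 / 3 \<and>
                 (\<forall>(y, s) \<in> set_pmf P.
                    real (oracle_calls s) \<le> soft_bound c a k n \<epsilon> \<and>
                    real (entry_queries s) \<le> c * real n * log 2 (1 / \<epsilon>) \<and>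
                    (\<forall>T. real n \<le> T \<longrightarrow> running_time T s \<le> soft_bound c a k n \<epsilon> * T)))))))"
proof (rule exI[of _ 64], rule exI[of _ 5], rule exI[of _ 2], intro allI impI, goal_cases)
  case (1 c_t c_L c_Q C)
  \<comment> \<open>One constant dominates all given ones; the summand 1 ensures
    \<open>1 \<le> b\<close>, so that high powers absorb low ones.\<close>
  define b where "b = 1 + \<bar>c_t\<bar> + \<bar>c_L\<bar> + \<bar>c_Q\<bar> + \<bar>C\<bar>"
  have b: "1 \<le> b" "c_t \<le> b" "c_L \<le> b" "c_Q \<le> b" "C \<le> b" by (auto simp: b_def)
  have C: "2 \<le> C" using 1 by simp
  show ?case
  proof (rule exI[of _ "340 * b ^ 6"], rule exI[of _ "4 * b"], rule exI[of _ 3], intro allI impI, goal_cases)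
    case (1 n M \<epsilon> Orc t)
    note n = 1(1) and M = 1(2) and \<epsilon> = 1(3,4) and orc = 1(5) and t = 1(6,7)
    have l: "1 \<le> log 2 (1 / \<epsilon>)" using \<epsilon> by (simp add: le_log_iff field_simps)
    have t1: "1 \<le> t" using l t(1) by linarith
    have mono_b: "c * log 2 (1 / \<epsilon>) \<le> b * log 2 (1 / \<epsilon>)" if "c \<le> b" for c
      using that l by (intro mult_right_mono) auto
    obtain V where V: "BR_subspace n t \<epsilon> (agreement_set n M Orc) V" "real (codim n V) \<le> 64 * log 2 (1 / \<epsilon>)"
      by (rule bogolyubov_ruzsa[OF _ \<epsilon> agreement_set_density[OF orc] t(1)]) (auto simp: agreement_set_def)
    show ?case
    proof (intro exI[of _ V] conjI V allI impI, goal_cases)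
      case (1 L split pick x)
      then have "warm_up split pick" by unfold_locales
      then show ?case using n t1 1(5) by (rule bounds_correct_calls_exists)
    next
      case (2 L split pick x Q)
      note L = 2(1,2) and x = 2(5) and Q = 2(6,7)
      have w: "warm_up split pick" using 2(3,4) by unfold_locales
      define R where "R = repetitions C \<epsilon> t Q"
      interpret warm_up_analysis n M Orc t R split pick V \<epsilon>
        using w orc V M n t1 \<epsilon>
        by (intro warm_up_analysis.intro warm_up_analysis_axioms.intro) (auto simp: errorless_with_agreement_def)
      define X where "X = real Q * 2 ^ L * (real R + 1) * (10 * real L + 18 * real t + 40)"
      have Lb: "real L \<le> b * log 2 (1 / \<epsilon>)" using L(2) mono_b[OF b(3)] by linarith
      have tb: "real t \<le> b * log 2 (1 / \<epsilon>)" using t(2) mono_b[OF b(2)] by linarith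
      have "c_Q * (real L * log 2 (real n + 1)) \<le> b * (real L * log 2 (real n + 1))"
        using b by (intro mult_right_mono) auto
      then have X: "X \<le> soft_bound (340 * b ^ 6) (4 * b) 3 n \<epsilon>"
        unfolding X_def R_def using b C \<epsilon> n tb Lb Q(2)
        by (intro cost_factor_le_soft_bound) auto
      have calls: "correct_calls s \<le> Q" if "(y, s) \<in> set_pmf (run (warmup L x))" for y s
        using Q(1) that unfolding bounds_correct_calls_def by fast
      have "2 / 3 \<le> measure_pmf.prob (run (warmup L x)) {(y, s). y = Some (M *\<^sub>v x)}"
        using prob_warmup[OF L(1) x, of Q] failure_le_third[of \<epsilon> C t Q] \<epsilon> C calls
        by (auto simp: R_def always_def)
      moreover have "real (oracle_calls s) \<le> soft_bound (340 * b ^ 6) (4 * b) 3 n \<epsilon> \<and>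
          real (entry_queries s) \<le> 340 * b ^ 6 * real n * log 2 (1 / \<epsilon>) \<and>
          (\<forall>T. real n \<le> T \<longrightarrow> running_time T s \<le> soft_bound (340 * b ^ 6) (4 * b) 3 n \<epsilon> * T)"
        if ys: "(y, s) \<in> set_pmf (run (warmup L x))" for y s
      proof (intro conjI allI impI)
        note cost = warmup_total_cost[OF w n t1 x ys calls[OF ys], folded X_def]
        show "real (oracle_calls s) \<le> soft_bound (340 * b ^ 6) (4 * b) 3 n \<epsilon>"
          using cost(1) X by linarith
        have "real (entry_queries s) \<le> real L * real n"
          using cost(2) by (metis of_nat_le_iff of_nat_mult)
        also have "\<dots> \<le> b * log 2 (1 / \<epsilon>) * real n"
          using Lb by (intro mult_right_mono) auto
        \<comment> \<open>The same constant must serve the entry queries and the soft bound, hence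
          the generous factor.\<close>
        also have "\<dots> \<le> 340 * b ^ 6 * log 2 (1 / \<epsilon>) * real n"
          using l b(1) self_le_power[of b 6] by (intro mult_right_mono) auto
        finally show "real (entry_queries s) \<le> 340 * b ^ 6 * real n * log 2 (1 / \<epsilon>)"
          by (simp add: mult_ac)
        fix T assume T: "real n \<le> T"
        have "X * T \<le> soft_bound (340 * b ^ 6) (4 * b) 3 n \<epsilon> * T"
          using X T by (intro mult_right_mono) auto
        with cost(3)[OF T] show "running_time T s \<le> soft_bound (340 * b ^ 6) (4 * b) 3 n \<epsilon> * T" by linarith
      qed
      ultimately show ?case
        unfolding Let_def R_def[symmetric] by fast
    qed
  qed
qed

end
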